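(* Let $S14o$ be the bialgebra and $\tilde A,\tilde B,\tilde C,\tilde D$ the linear functionals on $S14o$ defined in the context, let $K=(-1)^{\tilde A}$, and let $s14o$ be the algebra they generate with the structure dual to that of $S14o$. Then $$[\tilde A,Z]=0\ (Z=\tilde B,\tilde C,\tilde D),\qquad [\tilde B,\tilde C]=-2\tilde D,\quad [\tilde B,\tilde D]=-2\tilde C,\quad [\tilde C,\tilde D]=-2\tilde B;$$ $$\delta(\tilde A)=\tilde A\otimes1+1\otimes\tilde A,\quad \delta(\tilde B)=\tilde B\otimes1+1\otimes\tilde B,\quad \delta(\tilde C)=\tilde C\otimes K+1\otimes\tilde C,\quad \delta(\tilde D)=\tilde D\otimes K+1\otimes\tilde D;$$ $$\varepsilon(Z)=0\quad(Z=\tilde A,\tilde B,\tilde C,\tilde D);$$ and $s14o$ has an antipode $\gamma$ given by $$\gamma(\tilde A)=-\tilde A,\qquad \gamma(\tilde B)=-\tilde B,\qquad \gamma(\tilde C)=-\tilde CK,\qquad \gamma(\tilde D)=-\tilde DK .$$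
   Context: $S14o$ is the unital associative $\mathbb{C}$-algebra generated by $\tilde a,\tilde b,\tilde c,\tilde d$ with relations $\tilde b\tilde a=\tilde a\tilde b$, $\tilde c\tilde a=-\tilde a\tilde c$, $\tilde d\tilde a=-\tilde a\tilde d$, $\tilde c\tilde b=-\tilde b\tilde c$, $\tilde d\tilde b=-\tilde b\tilde d$, $\tilde d\tilde c=\tilde c\tilde d$, with basis $\tilde a^k\tilde b^\ell\tilde c^m\tilde d^n$ ($k,\ell,m,n\ge0$). It is a bialgebra with $\delta\tilde a=\tilde a\otimes\tilde a+\tilde b\otimes\tilde b-\tilde c\otimes\tilde c+\tilde d\otimes\tilde d$, $\delta\tilde b=\tilde a\otimes\tilde b+\tilde b\otimes\tilde a-\tilde c\otimes\tilde d+\tilde d\otimes\tilde c$, $\delta\tilde c=\tilde a\otimes\tilde c+\tilde c\otimes\tilde a-\tilde b\otimes\tilde d+\tilde d\otimes\tilde b$, $\delta\tilde d=\tilde a\otimes\tilde d+\tilde d\otimes\tilde a-\tilde b\otimes\tilde c+\tilde c\otimes\tilde b$, $\varepsilon(\tilde a)=1$, $\varepsilon(\tilde b)=\varepsilon(\tilde c)=\varepsilon(\tilde d)=0$. Functionals on basis monomials $f$ ($k\ge0$): $\langle\tilde A,f\rangle=k$ if $f=\tilde a^k$, else $0$; $\langle\tilde B,f\rangle=1$ if $f=\tilde a^k\tilde b$, else $0$; $\langle\tilde C,f\rangle=1$ if $f=\tilde a^k\tilde c$, else $0$; $\langle\tilde D,f\rangle=1$ if $f=\tilde a^k\tilde d$,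 else $0$. $K=(-1)^{\tilde A}$ is the functional with $\langle K,\tilde a^k\rangle=(-1)^k$ and zero on the other basis monomials; it is adjoined to $s14o$ whenever the coalgebra structure is considered. Duality: the product of functionals is $\langle uv,f\rangle=\langle u\otimes v,\delta(f)\rangle$, the unit $1$ is the counit of $S14o$, the coproduct is characterized by $\langle u,fg\rangle=\langle\delta(u),f\otimes g\rangle$ for all $f,g\in S14o$, and the counit is $\varepsilon(u)=\langle u,1\rangle$. *)

theory Defs
  imports Complex_Main "HOL-Library.Poly_Mapping"
begin

section \<open>Complex vector spaces and complex algebras\<close>

class complex_vector = ab_group_add +
  fixes scaleC :: "complex \<Rightarrow> 'a \<Rightarrow> 'a"  (infixr "*\<^sub>C" 75)
  assumes scaleC_add_right: "c *\<^sub>C (x + y) = c *\<^sub>C x + c *\<^sub>C y"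
    and scaleC_add_left: "(c + d) *\<^sub>C x = c *\<^sub>C x + d *\<^sub>C x"
    and scaleC_scaleC [simp]: "c *\<^sub>C d *\<^sub>C x = (c * d) *\<^sub>C x"
    and scaleC_one [simp]: "1 *\<^sub>C x = x"

global_interpretation cvec: vector_space "scaleC :: complex \<Rightarrow> 'a \<Rightarrow> 'a::complex_vector"
  by unfold_locales (simp_all add: scaleC_add_right scaleC_add_left)

declare cvec.scale_zero_left [simp] cvec.scale_zero_right [simp]

abbreviation clinear :: "('a::complex_vector \<Rightarrow> 'b::complex_vector) \<Rightarrow> bool"
  where "clinear \<equiv> Vector_Spaces.linear scaleC scaleC"

definition cbilinear :: "('a::complex_vector \<Rightarrow> 'b::complex_vector \<Rightarrow> 'c::complex_vector) \<Rightarrow> bool"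
  where "cbilinear B \<longleftrightarrow> (\<forall>x. clinear (B x)) \<and> (\<forall>y. clinear (\<lambda>x. B x y))"

text \<open>Unital and associative; the degenerate case \<open>0 = 1\<close> is allowed, unlike in the class
  \<^class>\<open>ring_1\<close>.\<close>

class complex_algebra = complex_vector + ring + monoid_mult +
  assumes scaleC_mult_left: "(c *\<^sub>C x) * y = c *\<^sub>C (x * y)"
    and scaleC_mult_right: "x * (c *\<^sub>C y) = c *\<^sub>C (x * y)"

definition algebra_hom :: "('a::complex_algebra \<Rightarrow> 'b::complex_algebra) \<Rightarrow> bool"
  where "algebra_hom f \<longleftrightarrow> clinear f \<and> f 1 = 1 \<and> (\<forall>x y. f (x * y) = f x * f y)"

definition commutator :: "'a::complex_algebra \<Rightarrow> 'a \<Rightarrow> 'a"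
  where "commutator x y = x * y - y * x"

instantiation complex :: complex_algebra
begin
definition scaleC_complex :: "complex \<Rightarrow> complex \<Rightarrow> complex"
  where "scaleC_complex c x = c * x"
instance
  by standard (simp_all add: scaleC_complex_def algebra_simps)
end

lemma scaleC_complex [simp]: "c *\<^sub>C x = c * (x::complex)"
  by (fact scaleC_complex_def)

text \<open>Keeps the simplifier from rewriting the scalar multiplication inside \<open>clinear f\<close>.\<close>

lemma linear_weak_cong [cong]:
  "f = g \<Longrightarrow> Vector_Spaces.linear s s' f = Vector_Spaces.linear s s' g"
  by simp

lemma clinearI:
  "(\<And>x y. f (x + y) = f x + f y) \<Longrightarrow> (\<And>c x. f (c *\<^sub>C x) = c *\<^sub>C f x) \<Longrightarrow> clinear f"
  by (simp add: Vector_Spaces.linear_iff cvec.vector_space_axioms)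

lemma clinear_add: "clinear f \<Longrightarrow> f (x + y) = f x + f y"
  and clinear_scale: "clinear f \<Longrightarrow> f (c *\<^sub>C x) = c *\<^sub>C f x"
  by (simp_all add: Vector_Spaces.linear_iff)

lemma clinear_0: "clinear f \<Longrightarrow> f 0 = 0"
  using clinear_scale[of f 0 0] by simp

lemma clinear_diff: "clinear f \<Longrightarrow> f (x - y) = f x - f y"
  using clinear_add[of f "x - y" y] by simp

lemma clinear_minus: "clinear f \<Longrightarrow> f (- x) = - f x"
  using clinear_diff[of f 0 x] by (simp add: clinear_0)

lemma clinear_sum: "clinear f \<Longrightarrow> f (sum g A) = (\<Sum>x\<in>A. f (g x))"
  by (induction A rule: infinite_finite_induct) (simp_all add: clinear_0 clinear_add)

lemma clinear_compose: "clinear f \<Longrightarrow> clinear g \<Longrightarrow> clinear (\<lambda>x. f (g x))"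
  by (rule clinearI) (simp_all add: clinear_add clinear_scale)

lemma clinear_ident: "clinear (\<lambda>x. x)" "clinear id"
  by (rule clinearI; simp)+

lemma clinear_plus: "clinear f \<Longrightarrow> clinear g \<Longrightarrow> clinear (\<lambda>x. f x + g x)"
  by (rule clinearI) (simp_all add: clinear_add clinear_scale scaleC_add_right)

lemma clinear_scaleC: "clinear f \<Longrightarrow> clinear (\<lambda>x. c *\<^sub>C f x)"
  by (rule clinearI) (simp_all add: clinear_add clinear_scale scaleC_add_right mult.commute)

lemma cbilinearI:
  "(\<And>x x' y. B (x + x') y = B x y + B x' y) \<Longrightarrow> (\<And>c x y. B (c *\<^sub>C x) y = c *\<^sub>C B x y) \<Longrightarrow>
   (\<And>x y y'. B x (y + y') = B x y + B x y') \<Longrightarrow> (\<And>c x y. B x (c *\<^sub>C y) = c *\<^sub>C B x y) \<Longrightarrow>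
   cbilinear B"
  unfolding cbilinear_def by (intro conjI allI clinearI)

lemma cbilinearD:
  assumes "cbilinear B"
  shows "B (x + x') y = B x y + B x' y" "B (c *\<^sub>C x) y = c *\<^sub>C B x y"
    "B x (y + y') = B x y + B x y'" "B x (c *\<^sub>C y) = c *\<^sub>C B x y"
proof -
  have l: "clinear (\<lambda>x. B x y)" for y
    using assms by (auto simp: cbilinear_def)
  have r: "clinear (B x)" for x
    using assms by (auto simp: cbilinear_def)
  show "B (x + x') y = B x y + B x' y" "B (c *\<^sub>C x) y = c *\<^sub>C B x y"
    "B x (y + y') = B x y + B x y'" "B x (c *\<^sub>C y) = c *\<^sub>C B x y"
    using clinear_add[OF l] clinear_scale[OF l] clinear_add[OF r] clinear_scale[OF r] by auto
qed

section \<open>Free vector spaces\<close>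

instantiation poly_mapping :: (type, complex_vector) complex_vector
begin
lift_definition scaleC_poly_mapping :: "complex \<Rightarrow> ('a \<Rightarrow>\<^sub>0 'b) \<Rightarrow> 'a \<Rightarrow>\<^sub>0 'b"
  is "\<lambda>c f k. c *\<^sub>C f k"
  by (erule rev_finite_subset) auto
instance
  by standard (transfer; simp add: fun_eq_iff scaleC_add_right scaleC_add_left)+
end

lemma scaleC_single [simp]: "c *\<^sub>C Poly_Mapping.single k d = Poly_Mapping.single k (c *\<^sub>C d)"
  by (rule poly_mapping_eqI) (simp add: scaleC_poly_mapping.rep_eq lookup_single when_def)

lemma free_induct [case_names single add]:
  fixes p :: "'k \<Rightarrow>\<^sub>0 complex"
  assumes "\<And>k c. P (Poly_Mapping.single k c)" and "\<And>p q. P p \<Longrightarrow> P q \<Longrightarrow> P (p + q)"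
  shows "P p"
proof (induction p rule: update_induct)
  case const
  then show ?case using assms(1)[of undefined 0] by simp
next
  case (update f a b)
  have "Poly_Mapping.update a b f = Poly_Mapping.single a b + f"
    using update(1) by (intro poly_mapping_eqI)
      (auto simp: lookup_update lookup_add lookup_single when_def in_keys_iff)
  then show ?case using assms(1)[of a b] assms(2) update(3) by metis
qed

definition free_extend :: "('k \<Rightarrow> 'v::complex_vector) \<Rightarrow> ('k \<Rightarrow>\<^sub>0 complex) \<Rightarrow> 'v"
  where "free_extend g p = (\<Sum>k\<in>Poly_Mapping.keys p. Poly_Mapping.lookup p k *\<^sub>C g k)"

lemma free_extend_superset:
  assumes "finite S" "Poly_Mapping.keys p \<subseteq> S"
  shows "free_extend g p = (\<Sum>k\<in>S. Poly_Mapping.lookup p k *\<^sub>C g k)"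
  unfolding free_extend_def
  using assms by (intro sum.mono_neutral_left) (auto simp: in_keys_iff)

lemma clinear_free_extend: "clinear (free_extend g)"
proof (rule clinearI)
  fix p q :: "'a \<Rightarrow>\<^sub>0 complex" and c
  let ?S = "Poly_Mapping.keys p \<union> Poly_Mapping.keys q \<union> Poly_Mapping.keys (p + q)"
  have "free_extend g (p + q) = (\<Sum>k\<in>?S. Poly_Mapping.lookup (p + q) k *\<^sub>C g k)"
    "free_extend g p = (\<Sum>k\<in>?S. Poly_Mapping.lookup p k *\<^sub>C g k)"
    "free_extend g q = (\<Sum>k\<in>?S. Poly_Mapping.lookup q k *\<^sub>C g k)"
    by (intro free_extend_superset; auto)+
  then show "free_extend g (p + q) = free_extend g p + free_extend g q"
    by (simp add: lookup_add scaleC_add_left sum.distrib)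
  let ?T = "Poly_Mapping.keys p \<union> Poly_Mapping.keys (c *\<^sub>C p)"
  have "free_extend g (c *\<^sub>C p) = (\<Sum>k\<in>?T. Poly_Mapping.lookup (c *\<^sub>C p) k *\<^sub>C g k)"
    "free_extend g p = (\<Sum>k\<in>?T. Poly_Mapping.lookup p k *\<^sub>C g k)"
    by (intro free_extend_superset; auto)+
  then show "free_extend g (c *\<^sub>C p) = c *\<^sub>C free_extend g p"
    by (simp add: scaleC_poly_mapping.rep_eq cvec.scale_sum_right)
qed

lemma free_extend_single [simp]: "free_extend g (Poly_Mapping.single k c) = c *\<^sub>C g k"
  by (cases "c = 0") (auto simp: free_extend_def)

lemma clinear_vanish_span:
  assumes "clinear f" "\<And>r. r \<in> R \<Longrightarrow> f r = 0" "p \<in> cvec.span R"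
  shows "f p = 0"
  using assms(3)
  by (induction rule: cvec.span_induct_alt)
    (simp_all add: assms clinear_0 clinear_add clinear_scale)

section \<open>Tensor products\<close>

text \<open>The free vector space on pairs modulo the bilinearity relations.\<close>

definition tensor_relators :: "('a::complex_vector \<times> 'b::complex_vector \<Rightarrow>\<^sub>0 complex) set"
  where "tensor_relators =
    {Poly_Mapping.single (x + x', y) 1 - Poly_Mapping.single (x, y) 1 - Poly_Mapping.single (x', y) 1 | x x' y. True} \<union>
    {Poly_Mapping.single (x, y + y') 1 - Poly_Mapping.single (x, y) 1 - Poly_Mapping.single (x, y') 1 | x y y'. True} \<union>
    {Poly_Mapping.single (c *\<^sub>C x, y) 1 - c *\<^sub>C Poly_Mapping.single (x, y) 1 | c x y. True} \<union>
    {Poly_Mapping.single (x, c *\<^sub>C y) 1 - c *\<^sub>C Poly_Mapping.single (x, y) 1 | c x y. True}"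

definition tensor_eq ::
    "('a::complex_vector \<times> 'b::complex_vector \<Rightarrow>\<^sub>0 complex) \<Rightarrow> ('a \<times> 'b \<Rightarrow>\<^sub>0 complex) \<Rightarrow> bool"
  where "tensor_eq p q \<longleftrightarrow> p - q \<in> cvec.span tensor_relators"

lemma equivp_diff_span: "equivp (\<lambda>p q. p - q \<in> cvec.span (R :: 'a::complex_vector set))"
proof (rule equivpI)
  show "reflp (\<lambda>p q. p - q \<in> cvec.span R)"
    by (auto simp: reflp_def cvec.span_zero)
  show "symp (\<lambda>p q. p - q \<in> cvec.span R)"
    using cvec.span_neg[of "x - y" R for x y] by (auto intro!: sympI)
  show "transp (\<lambda>p q. p - q \<in> cvec.span R)"
  proof (rule transpI)
    fix x y z assume "x - y \<in> cvec.span R" "y - z \<in> cvec.span R"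
    then have "(x - y) + (y - z) \<in> cvec.span R" by (rule cvec.span_add)
    then show "x - z \<in> cvec.span R" by simp
  qed
qed

quotient_type (overloaded) ('a, 'b) tensor =
    "'a::complex_vector \<times> 'b::complex_vector \<Rightarrow>\<^sub>0 complex" / tensor_eq
  unfolding tensor_eq_def by (rule equivp_diff_span)

instantiation tensor :: (complex_vector, complex_vector) complex_vector
begin
lift_definition zero_tensor :: "('a, 'b) tensor" is 0 .
lift_definition plus_tensor :: "('a, 'b) tensor \<Rightarrow> ('a, 'b) tensor \<Rightarrow> ('a, 'b) tensor" is "(+)"
  unfolding tensor_eq_def by (simp add: add_diff_add cvec.span_add)
lift_definition uminus_tensor :: "('a, 'b) tensor \<Rightarrow> ('a, 'b) tensor" is uminus
  unfolding tensor_eq_def minus_diff_minus by (rule cvec.span_neg)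
lift_definition minus_tensor :: "('a, 'b) tensor \<Rightarrow> ('a, 'b) tensor \<Rightarrow> ('a, 'b) tensor" is "(-)"
proof -
  fix p p' q q' :: "'a \<times> 'b \<Rightarrow>\<^sub>0 complex"
  assume "tensor_eq p p'" "tensor_eq q q'"
  then have "(p - p') - (q - q') \<in> cvec.span tensor_relators"
    unfolding tensor_eq_def by (rule cvec.span_diff)
  then show "tensor_eq (p - q) (p' - q')"
    by (simp add: tensor_eq_def algebra_simps)
qed
lift_definition scaleC_tensor :: "complex \<Rightarrow> ('a, 'b) tensor \<Rightarrow> ('a, 'b) tensor" is scaleC
  unfolding tensor_eq_def cvec.scale_right_diff_distrib[symmetric] by (rule cvec.span_scale)
instance
  by standard
    (transfer; simp add: tensor_eq_def cvec.span_zero algebra_simps scaleC_add_right scaleC_add_left)+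
end

lift_definition tensor :: "'a::complex_vector \<Rightarrow> 'b::complex_vector \<Rightarrow> ('a, 'b) tensor"  (infixr "\<otimes>" 76)
  is "\<lambda>x y. Poly_Mapping.single (x, y) 1" .

lemma cbilinear_tensor: "cbilinear (\<otimes>)"
proof (rule cbilinearI; transfer)
  fix x x' :: 'a and y y' :: 'b and c
  show "tensor_eq (Poly_Mapping.single (x + x', y) 1) (Poly_Mapping.single (x, y) 1 + Poly_Mapping.single (x', y) 1)"
    unfolding tensor_eq_def tensor_relators_def diff_diff_eq[symmetric]
    by (rule cvec.span_base) blast
  show "tensor_eq (Poly_Mapping.single (x, y + y') 1) (Poly_Mapping.single (x, y) 1 + Poly_Mapping.single (x, y') 1)"
    unfolding tensor_eq_def tensor_relators_def diff_diff_eq[symmetric]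
    by (rule cvec.span_base) blast
  show "tensor_eq (Poly_Mapping.single (c *\<^sub>C x, y) 1) (c *\<^sub>C Poly_Mapping.single (x, y) 1)"
    unfolding tensor_eq_def tensor_relators_def
    by (rule cvec.span_base) blast
  show "tensor_eq (Poly_Mapping.single (x, c *\<^sub>C y) 1) (c *\<^sub>C Poly_Mapping.single (x, y) 1)"
    unfolding tensor_eq_def tensor_relators_def
    by (rule cvec.span_base) blast
qed

lemmas tensor_add_left = cbilinearD(1)[OF cbilinear_tensor]
  and tensor_scaleC_left = cbilinearD(2)[OF cbilinear_tensor]
  and tensor_add_right = cbilinearD(3)[OF cbilinear_tensor]
  and tensor_scaleC_right = cbilinearD(4)[OF cbilinear_tensor]

lemma tensor_induct [case_names pure add]:
  assumes pure: "\<And>x y. P (x \<otimes> y)" and add: "\<And>s t. P s \<Longrightarrow> P t \<Longrightarrow> P (s + t)"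
  shows "P t"
proof (induction t rule: tensor.abs_induct)
  fix p :: "'a \<times> 'b \<Rightarrow>\<^sub>0 complex"
  show "P (abs_tensor p)"
  proof (induction p rule: free_induct)
    case (single k c)
    obtain x y where k: "k = (x, y)" by (cases k)
    have "abs_tensor (Poly_Mapping.single k c) = (c *\<^sub>C x) \<otimes> y"
      unfolding k tensor_scaleC_left by (simp add: tensor.abs_eq scaleC_tensor.abs_eq)
    then show ?case using pure by simp
  next
    case (add p q)
    then show ?case using assms(2) by (metis plus_tensor.abs_eq)
  qed
qed

text \<open>The linear map on the tensor product induced by a bilinear map.\<close>

definition tensor_lift ::
    "('a::complex_vector \<Rightarrow> 'b::complex_vector \<Rightarrow> 'c::complex_vector) \<Rightarrow> ('a, 'b) tensor \<Rightarrow> 'c"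
  where "tensor_lift B t = free_extend (\<lambda>(x, y). B x y) (rep_tensor t)"

lemma tensor_lift_abs:
  assumes "cbilinear B"
  shows "tensor_lift B (abs_tensor p) = free_extend (\<lambda>(x, y). B x y) p"
proof -
  let ?f = "free_extend (\<lambda>(x, y). B x y)"
  have "tensor_eq (rep_tensor (abs_tensor p)) p"
    using Quotient3_tensor by (metis Quotient3_def tensor.abs_eq_iff)
  then have "?f (rep_tensor (abs_tensor p) - p) = 0"
    unfolding tensor_eq_def
  proof (rule clinear_vanish_span[OF clinear_free_extend, rotated])
    fix r :: "'a \<times> 'b \<Rightarrow>\<^sub>0 complex" assume "r \<in> tensor_relators"
    then show "?f r = 0"
      unfolding tensor_relators_def
      by (auto simp: clinear_diff[OF clinear_free_extend] cbilinearD[OF assms])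
  qed
  then show ?thesis
    by (simp add: tensor_lift_def clinear_diff[OF clinear_free_extend])
qed

lemma clinear_tensor_lift: "cbilinear B \<Longrightarrow> clinear (tensor_lift B)"
proof (rule clinearI)
  assume B: "cbilinear B"
  fix s t c
  show "tensor_lift B (s + t) = tensor_lift B s + tensor_lift B t"
    by (induction s rule: tensor.abs_induct, induction t rule: tensor.abs_induct)
      (simp add: plus_tensor.abs_eq tensor_lift_abs[OF B] clinear_add[OF clinear_free_extend])
  show "tensor_lift B (c *\<^sub>C t) = c *\<^sub>C tensor_lift B t"
    by (induction t rule: tensor.abs_induct)
      (simp add: scaleC_tensor.abs_eq tensor_lift_abs[OF B] clinear_scale[OF clinear_free_extend])
qed

lemma tensor_lift_tensor [simp]: "cbilinear B \<Longrightarrow> tensor_lift B (x \<otimes> y) = B x y"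
  by (simp add: tensor.abs_eq tensor_lift_abs)

lemma tensor_lift_add: "cbilinear B \<Longrightarrow> tensor_lift B (s + t) = tensor_lift B s + tensor_lift B t"
  and tensor_lift_scaleC: "cbilinear B \<Longrightarrow> tensor_lift B (c *\<^sub>C t) = c *\<^sub>C tensor_lift B t"
  by (simp_all add: clinear_add clinear_scale clinear_tensor_lift)

lemma clinear_tensor_eqI:
  assumes "clinear f" "clinear g" "\<And>x y. f (x \<otimes> y) = g (x \<otimes> y)"
  shows "f t = g t"
  by (induction t rule: tensor_induct) (simp_all add: assms clinear_add)

lemma tensor_lift_fun_add:
  "tensor_lift (\<lambda>x y. B x y + B' x y) t = tensor_lift B t + tensor_lift B' t"
  by (simp add: tensor_lift_def free_extend_def case_prod_beta scaleC_add_right sum.distrib)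

lemma tensor_lift_fun_scaleC:
  "tensor_lift (\<lambda>x y. c *\<^sub>C B x y) t = c *\<^sub>C tensor_lift B t"
  by (simp add: tensor_lift_def free_extend_def case_prod_beta cvec.scale_sum_right mult.commute)

definition tensor_map :: "('a::complex_vector \<Rightarrow> 'c::complex_vector) \<Rightarrow>
    ('b::complex_vector \<Rightarrow> 'd::complex_vector) \<Rightarrow> ('a, 'b) tensor \<Rightarrow> ('c, 'd) tensor"
  where "tensor_map f g = tensor_lift (\<lambda>x y. f x \<otimes> g y)"

definition tensor_assoc :: "(('a::complex_vector, 'b::complex_vector) tensor, 'c::complex_vector) tensor
    \<Rightarrow> ('a, ('b, 'c) tensor) tensor"
  where "tensor_assoc = tensor_lift (\<lambda>s z. tensor_lift (\<lambda>x y. x \<otimes> y \<otimes> z) s)"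

lemma cbilinear_tensor_mult:
  fixes x :: "'a::complex_algebra" and y :: "'b::complex_algebra"
  shows "cbilinear (\<lambda>x' y'. (x * x') \<otimes> (y * y'))"
  by (rule cbilinearI) (simp_all add: distrib_left scaleC_mult_right tensor_add_left tensor_add_right
      tensor_scaleC_left tensor_scaleC_right)

lemma cbilinear_tensor_mult':
  fixes t :: "('a::complex_algebra, 'b::complex_algebra) tensor"
  shows "cbilinear (\<lambda>x y. tensor_lift (\<lambda>x' y'. (x * x') \<otimes> (y * y')) t)"
  by (rule cbilinearI) (simp_all add: distrib_right scaleC_mult_left tensor_add_left tensor_add_right
      tensor_scaleC_left tensor_scaleC_right tensor_lift_fun_add tensor_lift_fun_scaleC)

lemma cbilinear_tensor_mult_right:
  fixes x' :: "'a::complex_algebra" and y' :: "'b::complex_algebra"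
  shows "cbilinear (\<lambda>x y. (x * x') \<otimes> (y * y'))"
  by (rule cbilinearI) (simp_all add: distrib_right scaleC_mult_left tensor_add_left tensor_add_right
      tensor_scaleC_left tensor_scaleC_right)

instantiation tensor :: (complex_algebra, complex_algebra) complex_algebra
begin
definition times_tensor :: "('a, 'b) tensor \<Rightarrow> ('a, 'b) tensor \<Rightarrow> ('a, 'b) tensor"
  where "s * t = tensor_lift (\<lambda>x y. tensor_lift (\<lambda>x' y'. (x * x') \<otimes> (y * y')) t) s"
definition one_tensor :: "('a, 'b) tensor"
  where "1 = 1 \<otimes> 1"
instance
proof
  have mult: "(x \<otimes> y) * (x' \<otimes> y') = (x * x') \<otimes> (y * y')" for x x' :: 'a and y y' :: 'b
    by (simp add: times_tensor_def cbilinear_tensor_mult cbilinear_tensor_mult_right)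
  have add1: "(s + t) * u = s * u + t * u" for s t u :: "('a, 'b) tensor"
    by (simp add: times_tensor_def tensor_lift_add cbilinear_tensor_mult')
  have add2: "u * (s + t) = u * s + u * t" for s t u :: "('a, 'b) tensor"
    by (simp add: times_tensor_def tensor_lift_add cbilinear_tensor_mult tensor_lift_fun_add)
  fix s t u :: "('a, 'b) tensor" and c
  show "(s + t) * u = s * u + t * u" by (fact add1)
  show "u * (s + t) = u * s + u * t" by (fact add2)
  show "(c *\<^sub>C s) * t = c *\<^sub>C (s * t)"
    by (simp add: times_tensor_def tensor_lift_scaleC cbilinear_tensor_mult')
  show "s * (c *\<^sub>C t) = c *\<^sub>C (s * t)"
    by (simp add: times_tensor_def tensor_lift_scaleC cbilinear_tensor_mult tensor_lift_fun_scaleC)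
  show "1 * s = s" "s * 1 = s"
    by (induction s rule: tensor_induct) (simp_all add: one_tensor_def mult add1 add2)
  show "(s * t) * u = s * (t * u)"
  proof (induction s rule: tensor_induct)
    case (pure x y)
    show ?case
    proof (induction t rule: tensor_induct)
      case (pure x' y')
      show ?case
        by (induction u rule: tensor_induct) (simp_all add: mult add1 add2 mult.assoc)
    qed (simp_all add: add1 add2)
  qed (simp_all add: add1 add2)
qed
end

lemma tensor_mult_tensor [simp]: "(x \<otimes> y) * (x' \<otimes> y') = (x * x') \<otimes> (y * y')"
  by (simp add: times_tensor_def cbilinear_tensor_mult cbilinear_tensor_mult_right)

section \<open>Bialgebras and antipodes\<close>

definition coalgebra :: "('a::complex_vector \<Rightarrow> ('a, 'a) tensor) \<Rightarrow> ('a \<Rightarrow> complex) \<Rightarrow> bool"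
  where "coalgebra \<delta> \<epsilon> \<longleftrightarrow> clinear \<delta> \<and> clinear \<epsilon> \<and>
    (\<forall>x. tensor_assoc (tensor_map \<delta> id (\<delta> x)) = tensor_map id \<delta> (\<delta> x)) \<and>
    (\<forall>x. tensor_lift (\<lambda>y z. \<epsilon> y *\<^sub>C z) (\<delta> x) = x) \<and>
    (\<forall>x. tensor_lift (\<lambda>y z. \<epsilon> z *\<^sub>C y) (\<delta> x) = x)"

definition bialgebra :: "('a::complex_algebra \<Rightarrow> ('a, 'a) tensor) \<Rightarrow> ('a \<Rightarrow> complex) \<Rightarrow> bool"
  where "bialgebra \<delta> \<epsilon> \<longleftrightarrow> coalgebra \<delta> \<epsilon> \<and> algebra_hom \<delta> \<and> algebra_hom \<epsilon>"

definition antipode ::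
    "('a::complex_algebra \<Rightarrow> ('a, 'a) tensor) \<Rightarrow> ('a \<Rightarrow> complex) \<Rightarrow> ('a \<Rightarrow> 'a) \<Rightarrow> bool"
  where "antipode \<delta> \<epsilon> \<gamma> \<longleftrightarrow> clinear \<gamma> \<and>
    (\<forall>x. tensor_lift (*) (tensor_map \<gamma> id (\<delta> x)) = \<epsilon> x *\<^sub>C 1) \<and>
    (\<forall>x. tensor_lift (*) (tensor_map id \<gamma> (\<delta> x)) = \<epsilon> x *\<^sub>C 1)"

lemma cbilinear_mult: "cbilinear ((*) :: 'a::complex_algebra \<Rightarrow> _)"
  by (rule cbilinearI) (simp_all add: distrib_left distrib_right scaleC_mult_left scaleC_mult_right)

lemma cbilinear_compose:
  assumes B: "cbilinear B" and f: "clinear f" and g: "clinear g"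
  shows "cbilinear (\<lambda>x y. B (f x) (g y))"
  by (rule cbilinearI)
    (simp_all add: clinear_add[OF f] clinear_scale[OF f] clinear_add[OF g] clinear_scale[OF g] cbilinearD[OF B])

lemma clinear_tensor_map: "clinear f \<Longrightarrow> clinear g \<Longrightarrow> clinear (tensor_map f g)"
  unfolding tensor_map_def
  by (intro clinear_tensor_lift cbilinear_compose[OF cbilinear_tensor])

lemma tensor_map_tensor [simp]:
  "clinear f \<Longrightarrow> clinear g \<Longrightarrow> tensor_map f g (x \<otimes> y) = f x \<otimes> g y"
  unfolding tensor_map_def by (simp add: cbilinear_compose[OF cbilinear_tensor])

lemma cbilinear_tensor_assoc1: "cbilinear (\<lambda>y z. x \<otimes> y \<otimes> z)"
  by (rule cbilinearI) (simp_all add: tensor_add_left tensor_add_right tensor_scaleC_left tensor_scaleC_right)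

lemma cbilinear_tensor_assoc2: "cbilinear (\<lambda>x y. x \<otimes> y \<otimes> z)"
  by (rule cbilinearI) (simp_all add: tensor_add_left tensor_add_right tensor_scaleC_left tensor_scaleC_right)

lemma cbilinear_tensor_assoc3: "cbilinear (\<lambda>s z. tensor_lift (\<lambda>x y. x \<otimes> y \<otimes> z) s)"
  by (rule cbilinearI) (simp_all add: cbilinear_tensor_assoc2 tensor_lift_add tensor_lift_scaleC
      tensor_add_right tensor_scaleC_right tensor_lift_fun_add tensor_lift_fun_scaleC)

lemmas cbilinear_tensor_assoc = cbilinear_tensor_assoc1 cbilinear_tensor_assoc2 cbilinear_tensor_assoc3

lemma clinear_tensor_assoc: "clinear tensor_assoc"
  unfolding tensor_assoc_def by (intro clinear_tensor_lift cbilinear_tensor_assoc)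

lemma tensor_assoc_tensor [simp]: "tensor_assoc ((x \<otimes> y) \<otimes> z) = x \<otimes> y \<otimes> z"
  unfolding tensor_assoc_def by (simp add: cbilinear_tensor_assoc)

lemma algebra_hom_tensorI:
  assumes f: "clinear f" and one: "f (1 \<otimes> 1) = 1"
    and mult: "\<And>x y x' y'. f ((x * x') \<otimes> (y * y')) = f (x \<otimes> y) * f (x' \<otimes> y')"
  shows "algebra_hom f"
  unfolding algebra_hom_def
proof (intro conjI allI)
  show "f 1 = 1" using one by (simp add: one_tensor_def)
  fix s t
  show "f (s * t) = f s * f t"
  proof (induction s rule: tensor_induct)
    case (pure x y)
    show ?case
      by (induction t rule: tensor_induct) (simp_all add: mult distrib_left clinear_add[OF f])
  qed (simp add: distrib_right clinear_add[OF f])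
qed (fact f)

lemma algebra_homD:
  assumes "algebra_hom f"
  shows "clinear f" "f 1 = 1" "f (x * y) = f x * f y"
  using assms by (auto simp: algebra_hom_def)

lemma algebra_hom_tensor_map:
  assumes f: "algebra_hom f" and g: "algebra_hom g"
  shows "algebra_hom (tensor_map f g)"
  by (rule algebra_hom_tensorI)
    (simp_all add: clinear_tensor_map algebra_homD[OF f] algebra_homD[OF g] one_tensor_def)

lemma algebra_hom_tensor_assoc:
  "algebra_hom (tensor_assoc :: (('a::complex_algebra, 'b::complex_algebra) tensor, 'c::complex_algebra) tensor \<Rightarrow> _)"
proof (rule algebra_hom_tensorI)
  show "clinear (tensor_assoc :: (('a, 'b) tensor, 'c) tensor \<Rightarrow> _)"
    by (fact clinear_tensor_assoc)
  show "tensor_assoc (1 \<otimes> 1 :: (('a, 'b) tensor, 'c) tensor) = 1"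
    by (simp add: one_tensor_def)
  fix s s' :: "('a, 'b) tensor" and z z' :: 'c
  note add = clinear_add[OF clinear_tensor_assoc]
  show "tensor_assoc ((s * s') \<otimes> (z * z')) = tensor_assoc (s \<otimes> z) * tensor_assoc (s' \<otimes> z')"
  proof (induction s rule: tensor_induct)
    case (pure x y)
    show ?case
      by (induction s' rule: tensor_induct) (simp_all add: distrib_left tensor_add_left add)
  qed (simp add: distrib_right tensor_add_left add)
qed

lemma algebra_hom_compose: "algebra_hom f \<Longrightarrow> algebra_hom g \<Longrightarrow> algebra_hom (\<lambda>x. f (g x))"
  by (simp add: algebra_hom_def clinear_compose)

lemma algebra_hom_id: "algebra_hom id"
  by (simp add: algebra_hom_def clinear_ident)

section \<open>The free algebra on four generators\<close>

datatype letter = La | Lb | Lc | Ld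

datatype word = Word (letters: "letter list")

instantiation word :: monoid_add
begin
definition zero_word :: word where "0 = Word []"
definition plus_word :: "word \<Rightarrow> word \<Rightarrow> word" where "u + v = Word (letters u @ letters v)"
instance
  by standard (simp_all add: zero_word_def plus_word_def)
end

text \<open>With this monoid structure on words, the product of \<^typ>\<open>word \<Rightarrow>\<^sub>0 complex\<close> is that of the
  free algebra.\<close>

type_synonym free_algebra = "word \<Rightarrow>\<^sub>0 complex"

definition free_gen :: "letter \<Rightarrow> free_algebra"
  where "free_gen x = Poly_Mapping.single (Word [x]) 1"

definition free_eval :: "(letter \<Rightarrow> 'a::complex_algebra) \<Rightarrow> free_algebra \<Rightarrow> 'a"
  where "free_eval g = free_extend (\<lambda>w. prod_list (map g (letters w)))"

lemma free_algebra_scaleC_left: "(c *\<^sub>C p) * q = c *\<^sub>C (p * q :: free_algebra)"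
proof (induction p rule: free_induct)
  case (single k d)
  show ?case
    by (induction q rule: free_induct)
      (simp_all add: mult_single distrib_left scaleC_add_right mult.assoc)
qed (simp add: distrib_right scaleC_add_right)

lemma free_algebra_scaleC_right: "p * (c *\<^sub>C q) = c *\<^sub>C (p * q :: free_algebra)"
proof (induction p rule: free_induct)
  case (single k d)
  show ?case
    by (induction q rule: free_induct)
      (simp_all add: mult_single distrib_left scaleC_add_right mult.left_commute)
qed (simp add: distrib_right scaleC_add_right)

lemma clinear_free_eval: "clinear (free_eval g)"
  unfolding free_eval_def by (rule clinear_free_extend)

lemma free_eval_single: "free_eval g (Poly_Mapping.single w c) = c *\<^sub>C prod_list (map g (letters w))"
  by (simp add: free_eval_def)

lemma free_eval_1: "free_eval g 1 = 1"
  by (simp add: free_eval_single zero_word_def flip: single_one)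

lemma free_eval_gen: "free_eval g (free_gen x) = g x"
  by (simp add: free_gen_def free_eval_single)

lemma free_eval_mult: "free_eval g (p * q) = free_eval g p * free_eval g q"
proof (induction p rule: free_induct)
  case (single u c)
  show ?case
    by (induction q rule: free_induct)
      (simp_all add: mult_single free_eval_single plus_word_def scaleC_mult_left scaleC_mult_right
        distrib_left clinear_add[OF clinear_free_eval])
qed (simp add: distrib_right clinear_add[OF clinear_free_eval])

section \<open>The bialgebra S14o\<close>

definition S14o_relators :: "free_algebra set"
  where "S14o_relators =
   (let a = free_gen La; b = free_gen Lb; c = free_gen Lc; d = free_gen Ld in
    {b * a - a * b, c * a + a * c, d * a + a * d, c * b + b * c, d * b + b * d, d * c - c * d})"

definition S14o_ideal :: "free_algebra set"
  where "S14o_ideal = cvec.span {u * r * v | u r v. r \<in> S14o_relators}"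

definition S14o_eq :: "free_algebra \<Rightarrow> free_algebra \<Rightarrow> bool"
  where "S14o_eq p q \<longleftrightarrow> p - q \<in> S14o_ideal"

lemma S14o_ideal_mult:
  assumes "p \<in> S14o_ideal"
  shows "u * p \<in> S14o_ideal" "p * v \<in> S14o_ideal"
proof -
  have "u * p * v \<in> S14o_ideal" for u v
    using assms unfolding S14o_ideal_def
  proof (induction p rule: cvec.span_induct_alt)
    case base
    show ?case by (simp add: cvec.span_zero)
  next
    case (step c x y)
    then obtain u' r v' where x: "x = u' * r * v'" and r: "r \<in> S14o_relators" by blast
    have "u * x * v = (u * u') * r * (v' * v)" by (simp add: x mult.assoc)
    then have "u * x * v \<in> cvec.span {u * r * v | u r v. r \<in> S14o_relators}"
      using r by (auto intro!: cvec.span_base)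
    then have "c *\<^sub>C (u * x * v) + u * y * v \<in> cvec.span {u * r * v | u r v. r \<in> S14o_relators}"
      using step by (intro cvec.span_add cvec.span_scale)
    then show ?case
      by (simp add: distrib_left distrib_right free_algebra_scaleC_left free_algebra_scaleC_right)
  qed
  from this[of u 1] this[of 1 v] show "u * p \<in> S14o_ideal" "p * v \<in> S14o_ideal" by simp_all
qed

quotient_type S14o = free_algebra / S14o_eq
  unfolding S14o_eq_def S14o_ideal_def by (rule equivp_diff_span)

instantiation S14o :: complex_algebra
begin
lift_definition zero_S14o :: S14o is 0 .
lift_definition one_S14o :: S14o is 1 .
lift_definition plus_S14o :: "S14o \<Rightarrow> S14o \<Rightarrow> S14o" is "(+)"
  unfolding S14o_eq_def S14o_ideal_def by (simp add: add_diff_add cvec.span_add)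
lift_definition uminus_S14o :: "S14o \<Rightarrow> S14o" is uminus
  unfolding S14o_eq_def S14o_ideal_def minus_diff_minus by (rule cvec.span_neg)
lift_definition minus_S14o :: "S14o \<Rightarrow> S14o \<Rightarrow> S14o" is "(-)"
proof -
  fix p p' q q' :: free_algebra
  assume "S14o_eq p p'" "S14o_eq q q'"
  then have "(p - p') - (q - q') \<in> S14o_ideal"
    unfolding S14o_eq_def S14o_ideal_def by (rule cvec.span_diff)
  then show "S14o_eq (p - q) (p' - q')"
    by (simp add: S14o_eq_def algebra_simps)
qed
lift_definition scaleC_S14o :: "complex \<Rightarrow> S14o \<Rightarrow> S14o" is scaleC
  unfolding S14o_eq_def S14o_ideal_def cvec.scale_right_diff_distrib[symmetric] by (rule cvec.span_scale)
lift_definition times_S14o :: "S14o \<Rightarrow> S14o \<Rightarrow> S14o" is "(*)"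
proof -
  fix p p' q q' :: free_algebra
  assume "S14o_eq p p'" "S14o_eq q q'"
  then have "(p - p') * q + p' * (q - q') \<in> S14o_ideal"
    unfolding S14o_eq_def using S14o_ideal_mult cvec.span_add unfolding S14o_ideal_def by blast
  then show "S14o_eq (p * q) (p' * q')"
    by (simp add: S14o_eq_def algebra_simps)
qed
instance
  by standard
    (transfer; simp add: S14o_eq_def S14o_ideal_def cvec.span_zero algebra_simps scaleC_add_right
      scaleC_add_left free_algebra_scaleC_left free_algebra_scaleC_right)+
end

lift_definition S14o_a :: S14o is "free_gen La" .
lift_definition S14o_b :: S14o is "free_gen Lb" .
lift_definition S14o_c :: S14o is "free_gen Lc" .
lift_definition S14o_d :: S14o is "free_gen Ld" .

lemma S14o_eqI: "p - q \<in> S14o_relators \<Longrightarrow> S14o_eq p q"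
  unfolding S14o_eq_def S14o_ideal_def
  by (intro cvec.span_base CollectI exI[of _ 1] exI[of _ "p - q"]) simp

lemma S14o_relations:
  "S14o_b * S14o_a = S14o_a * S14o_b"
  "S14o_c * S14o_a = - (S14o_a * S14o_c)"
  "S14o_d * S14o_a = - (S14o_a * S14o_d)"
  "S14o_c * S14o_b = - (S14o_b * S14o_c)"
  "S14o_d * S14o_b = - (S14o_b * S14o_d)"
  "S14o_d * S14o_c = S14o_c * S14o_d"
  by (transfer, rule S14o_eqI, simp add: S14o_relators_def Let_def)+

definition S14o_compatible :: "(letter \<Rightarrow> 'a::complex_algebra) \<Rightarrow> bool"
  where "S14o_compatible g \<longleftrightarrow>
    g Lb * g La = g La * g Lb \<and> g Lc * g La = - (g La * g Lc) \<and> g Ld * g La = - (g La * g Ld) \<and>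
    g Lc * g Lb = - (g Lb * g Lc) \<and> g Ld * g Lb = - (g Lb * g Ld) \<and> g Ld * g Lc = g Lc * g Ld"

lemma free_eval_relators:
  assumes "S14o_compatible g" "r \<in> S14o_relators"
  shows "free_eval g r = 0"
  using assms unfolding S14o_compatible_def S14o_relators_def Let_def
  by (auto simp: clinear_add[OF clinear_free_eval] clinear_diff[OF clinear_free_eval]
      free_eval_mult free_eval_gen)

lemma free_eval_respects:
  assumes "S14o_compatible g" "S14o_eq p q"
  shows "free_eval g p = free_eval g q"
proof -
  have "free_eval g (p - q) = 0"
    using assms(2) unfolding S14o_eq_def S14o_ideal_def
    by (rule clinear_vanish_span[OF clinear_free_eval, rotated])
      (auto simp: free_eval_mult free_eval_relators[OF assms(1)])
  then show ?thesis by (simp add: clinear_diff[OF clinear_free_eval])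
qed

primrec comul_letter :: "letter \<Rightarrow> (S14o, S14o) tensor" where
  "comul_letter La = S14o_a \<otimes> S14o_a + S14o_b \<otimes> S14o_b - S14o_c \<otimes> S14o_c + S14o_d \<otimes> S14o_d"
| "comul_letter Lb = S14o_a \<otimes> S14o_b + S14o_b \<otimes> S14o_a - S14o_c \<otimes> S14o_d + S14o_d \<otimes> S14o_c"
| "comul_letter Lc = S14o_a \<otimes> S14o_c + S14o_c \<otimes> S14o_a - S14o_b \<otimes> S14o_d + S14o_d \<otimes> S14o_b"
| "comul_letter Ld = S14o_a \<otimes> S14o_d + S14o_d \<otimes> S14o_a - S14o_b \<otimes> S14o_c + S14o_c \<otimes> S14o_b"

primrec counit_letter :: "letter \<Rightarrow> complex" where
  "counit_letter La = 1"
| "counit_letter Lb = 0"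
| "counit_letter Lc = 0"
| "counit_letter Ld = 0"

lemma tensor_minus_left: "(- x) \<otimes> y = - (x \<otimes> y)"
  using tensor_scaleC_left[of "-1" x y] by simp

lemma tensor_minus_right: "x \<otimes> (- y) = - (x \<otimes> y)"
  using tensor_scaleC_right[of x "-1" y] by simp

lemma tensor_diff_left: "(x - x') \<otimes> y = x \<otimes> y - x' \<otimes> y"
  using tensor_add_left[of x "- x'" y] by (simp add: tensor_minus_left)

lemma tensor_diff_right: "x \<otimes> (y - y') = x \<otimes> y - x \<otimes> y'"
  using tensor_add_right[of x y "- y'"] by (simp add: tensor_minus_right)

lemma compatible_comul_letter: "S14o_compatible comul_letter"
  unfolding S14o_compatible_def
  by (simp add: algebra_simps S14o_relations tensor_minus_left tensor_minus_right)

lemma compatible_counit_letter: "S14o_compatible counit_letter"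
  unfolding S14o_compatible_def by simp

lift_definition S14o_comul :: "S14o \<Rightarrow> (S14o, S14o) tensor" is "free_eval comul_letter"
  by (rule free_eval_respects[OF compatible_comul_letter])

lift_definition S14o_counit :: "S14o \<Rightarrow> complex" is "free_eval counit_letter"
  by (rule free_eval_respects[OF compatible_counit_letter])

lemma S14o_comul_gens [simp]:
  "S14o_comul S14o_a = S14o_a \<otimes> S14o_a + S14o_b \<otimes> S14o_b - S14o_c \<otimes> S14o_c + S14o_d \<otimes> S14o_d"
  "S14o_comul S14o_b = S14o_a \<otimes> S14o_b + S14o_b \<otimes> S14o_a - S14o_c \<otimes> S14o_d + S14o_d \<otimes> S14o_c"
  "S14o_comul S14o_c = S14o_a \<otimes> S14o_c + S14o_c \<otimes> S14o_a - S14o_b \<otimes> S14o_d + S14o_d \<otimes> S14o_b"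
  "S14o_comul S14o_d = S14o_a \<otimes> S14o_d + S14o_d \<otimes> S14o_a - S14o_b \<otimes> S14o_c + S14o_c \<otimes> S14o_b"
  by (subst S14o_a.abs_eq S14o_b.abs_eq S14o_c.abs_eq S14o_d.abs_eq, subst S14o_comul.abs_eq,
      simp add: free_eval_gen)+

lemma S14o_counit_gens [simp]:
  "S14o_counit S14o_a = 1" "S14o_counit S14o_b = 0" "S14o_counit S14o_c = 0" "S14o_counit S14o_d = 0"
  by (transfer; simp add: free_eval_gen)+

lemma algebra_hom_S14o_comul: "algebra_hom S14o_comul"
  unfolding algebra_hom_def
  by (intro conjI allI clinearI; transfer)
    (simp_all add: clinear_add[OF clinear_free_eval] clinear_scale[OF clinear_free_eval]
      free_eval_1 free_eval_mult)

lemma algebra_hom_S14o_counit: "algebra_hom S14o_counit"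
  unfolding algebra_hom_def
  by (intro conjI allI clinearI; transfer)
    (simp_all add: clinear_add[OF clinear_free_eval] clinear_scale[OF clinear_free_eval]
      free_eval_1 free_eval_mult)

lemma S14o_induct [case_names one gen add scale]:
  assumes "P 1"
    and gen: "\<And>x f. x \<in> {S14o_a, S14o_b, S14o_c, S14o_d} \<Longrightarrow> P f \<Longrightarrow> P (x * f)"
    and add: "\<And>f g. P f \<Longrightarrow> P g \<Longrightarrow> P (f + g)" and scale: "\<And>c f. P f \<Longrightarrow> P (c *\<^sub>C f)"
  shows "P f"
proof (induction f rule: S14o.abs_induct)
  fix p
  show "P (abs_S14o p)"
  proof (induction p rule: free_induct)
    case (single w c)
    have "P (abs_S14o (Poly_Mapping.single (Word xs) 1))" for xs
    proof (induction xs)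
      case Nil
      have "Poly_Mapping.single (Word []) 1 = (1 :: free_algebra)"
        by (simp add: zero_word_def[symmetric])
      then show ?case using \<open>P 1\<close> by (simp add: one_S14o.abs_eq)
    next
      case (Cons x xs)
      have "Poly_Mapping.single (Word (x # xs)) 1 = free_gen x * Poly_Mapping.single (Word xs) 1"
        by (simp add: free_gen_def mult_single plus_word_def)
      then have "abs_S14o (Poly_Mapping.single (Word (x # xs)) 1) =
          abs_S14o (free_gen x) * abs_S14o (Poly_Mapping.single (Word xs) 1)"
        by (simp add: times_S14o.abs_eq)
      moreover have "abs_S14o (free_gen x) \<in> {S14o_a, S14o_b, S14o_c, S14o_d}"
        by (cases x) (simp_all add: S14o_a.abs_eq S14o_b.abs_eq S14o_c.abs_eq S14o_d.abs_eq)
      ultimately show ?case using gen Cons by simp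
    qed
    from scale[OF this, of c "letters w"] show ?case by (simp add: scaleC_S14o.abs_eq)
  next
    case (add p q)
    then show ?case using assms(3) by (simp add: plus_S14o.abs_eq[symmetric])
  qed
qed

lemma S14o_hom_eqI:
  assumes "algebra_hom F" "algebra_hom G"
    "F S14o_a = G S14o_a" "F S14o_b = G S14o_b" "F S14o_c = G S14o_c" "F S14o_d = G S14o_d"
  shows "F f = G f"
proof (induction f rule: S14o_induct)
  case one
  show ?case by (simp add: algebra_homD(2)[OF assms(1)] algebra_homD(2)[OF assms(2)])
next
  case (gen x f)
  then show ?case
    using assms(3-6) by (auto simp: algebra_homD(3)[OF assms(1)] algebra_homD(3)[OF assms(2)])
next
  case (add f g)
  then show ?case
    by (simp add: clinear_add[OF algebra_homD(1)[OF assms(1)]] clinear_add[OF algebra_homD(1)[OF assms(2)]])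
next
  case (scale c f)
  then show ?case
    by (simp add: clinear_scale[OF algebra_homD(1)[OF assms(1)]] clinear_scale[OF algebra_homD(1)[OF assms(2)]])
qed

lemma S14o_coassoc: "tensor_assoc (tensor_map S14o_comul id (S14o_comul f)) = tensor_map id S14o_comul (S14o_comul f)"
proof (rule S14o_hom_eqI)
  note hom = algebra_hom_S14o_comul algebra_hom_id
  show "algebra_hom (\<lambda>f. tensor_assoc (tensor_map S14o_comul id (S14o_comul f)))"
    by (rule algebra_hom_compose[OF algebra_hom_tensor_assoc algebra_hom_compose[OF algebra_hom_tensor_map]])
      (fact hom)+
  show "algebra_hom (\<lambda>f. tensor_map id S14o_comul (S14o_comul f))"
    by (rule algebra_hom_compose[OF algebra_hom_tensor_map]) (fact hom)+
qed (insert algebra_homD(1)[OF algebra_hom_S14o_comul],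
    simp_all add: clinear_add[OF clinear_tensor_map] clinear_diff[OF clinear_tensor_map]
      clinear_add[OF clinear_tensor_assoc] clinear_diff[OF clinear_tensor_assoc] clinear_ident
      tensor_add_left tensor_add_right tensor_diff_left tensor_diff_right algebra_simps)

lemma tensor_lift_tensor_map:
  assumes "cbilinear B" "clinear f" "clinear g"
  shows "tensor_lift B (tensor_map f g t) = tensor_lift (\<lambda>x y. B (f x) (g y)) t"
proof (rule clinear_tensor_eqI)
  show "clinear (\<lambda>t. tensor_lift B (tensor_map f g t))"
    by (intro clinear_compose[OF clinear_tensor_lift clinear_tensor_map] assms)
  show "clinear (tensor_lift (\<lambda>x y. B (f x) (g y)))"
    by (intro clinear_tensor_lift cbilinear_compose[OF assms])
qed (simp add: assms cbilinear_compose[OF assms])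

lemma S14o_counit_left: "tensor_lift (\<lambda>x y. S14o_counit x *\<^sub>C y) (S14o_comul f) = f"
  and S14o_counit_right: "tensor_lift (\<lambda>x y. S14o_counit y *\<^sub>C x) (S14o_comul f) = f"
proof -
  note e = algebra_homD[OF algebra_hom_S14o_counit]
  have B: "cbilinear (\<lambda>x y. S14o_counit x *\<^sub>C (y::S14o))" "cbilinear (\<lambda>x y. S14o_counit y *\<^sub>C (x::S14o))"
    by (rule cbilinearI; simp add: clinear_add[OF e(1)] clinear_scale[OF e(1)] scaleC_add_left
        scaleC_add_right mult.commute)+
  have hom: "algebra_hom (tensor_lift (\<lambda>x y. S14o_counit x *\<^sub>C (y::S14o)))"
    "algebra_hom (tensor_lift (\<lambda>x y. S14o_counit y *\<^sub>C (x::S14o)))"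
    by (rule algebra_hom_tensorI;
        simp add: B clinear_tensor_lift e(2,3) scaleC_mult_left scaleC_mult_right mult.commute)+
  show "tensor_lift (\<lambda>x y. S14o_counit x *\<^sub>C y) (S14o_comul f) = f"
    by (rule S14o_hom_eqI[OF algebra_hom_compose[OF hom(1) algebra_hom_S14o_comul]
          algebra_hom_id[unfolded id_def]])
      (simp_all add: clinear_add[OF clinear_tensor_lift] clinear_diff[OF clinear_tensor_lift] B)
  show "tensor_lift (\<lambda>x y. S14o_counit y *\<^sub>C x) (S14o_comul f) = f"
    by (rule S14o_hom_eqI[OF algebra_hom_compose[OF hom(2) algebra_hom_S14o_comul]
          algebra_hom_id[unfolded id_def]])
      (simp_all add: clinear_add[OF clinear_tensor_lift] clinear_diff[OF clinear_tensor_lift] B)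
qed

lemma bialgebra_S14o: "bialgebra S14o_comul S14o_counit"
  unfolding bialgebra_def coalgebra_def
  using algebra_hom_S14o_comul algebra_hom_S14o_counit
  by (simp add: algebra_homD(1) S14o_coassoc S14o_counit_left S14o_counit_right)

subsection \<open>The monomial basis\<close>

abbreviation S14o_monomial :: "nat \<Rightarrow> nat \<Rightarrow> nat \<Rightarrow> nat \<Rightarrow> S14o"
  where "S14o_monomial k l m n \<equiv> S14o_a ^ k * S14o_b ^ l * S14o_c ^ m * S14o_d ^ n"

primrec word_exponents :: "letter list \<Rightarrow> nat \<times> nat \<times> nat \<times> nat" where
  "word_exponents [] = (0, 0, 0, 0)"
| "word_exponents (x # xs) = (case word_exponents xs of (k, l, m, n) \<Rightarrow>
    (case x of La \<Rightarrow> (Suc k, l, m, n) | Lb \<Rightarrow> (k, Suc l, m, n) | Lc \<Rightarrow> (k, l, Suc m, n) | Ld \<Rightarrow> (k, l, m, Suc n)))"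

text \<open>The sign picked up when a word is brought into normal order.\<close>

primrec word_sign :: "letter list \<Rightarrow> complex" where
  "word_sign [] = 1"
| "word_sign (x # xs) = (case word_exponents xs of (k, l, m, n) \<Rightarrow>
    (if x \<in> {Lc, Ld} then (-1) ^ (k + l) else 1)) * word_sign xs"

lemma anticommute_power:
  fixes x y :: "'a::complex_algebra"
  assumes "y * x = - (x * y)"
  shows "y * x ^ k = (-1) ^ k *\<^sub>C (x ^ k * y)"
proof (induction k)
  case (Suc k)
  have "y * x ^ Suc k = - (x * (y * x ^ k))"
    by (simp add: assms flip: mult.assoc)
  also have "\<dots> = - ((-1) ^ k *\<^sub>C (x ^ Suc k * y))"
    by (simp add: Suc scaleC_mult_right mult.assoc)
  finally show ?case by simp
qed simp

lemma commute_power: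
  fixes x y :: "'a::complex_algebra"
  assumes "y * x = x * y"
  shows "y * x ^ k = x ^ k * y"
  using power_commuting_commutes[OF assms[symmetric], of k] by simp

lemma gen_mult_monomial:
  "S14o_a * S14o_monomial k l m n = S14o_monomial (Suc k) l m n"
  "S14o_b * S14o_monomial k l m n = S14o_monomial k (Suc l) m n"
  "S14o_c * S14o_monomial k l m n = (-1) ^ (k + l) *\<^sub>C S14o_monomial k l (Suc m) n"
  "S14o_d * S14o_monomial k l m n = (-1) ^ (k + l) *\<^sub>C S14o_monomial k l m (Suc n)"
proof -
  note rel = commute_power[OF S14o_relations(1)] anticommute_power[OF S14o_relations(2)]
    anticommute_power[OF S14o_relations(3)] anticommute_power[OF S14o_relations(4)]
    anticommute_power[OF S14o_relations(5)] commute_power[OF S14o_relations(6)]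
  have rel': "S14o_b * (S14o_a ^ k * f) = S14o_a ^ k * (S14o_b * f)"
    "S14o_c * (S14o_a ^ k * f) = (-1) ^ k *\<^sub>C (S14o_a ^ k * (S14o_c * f))"
    "S14o_d * (S14o_a ^ k * f) = (-1) ^ k *\<^sub>C (S14o_a ^ k * (S14o_d * f))"
    "S14o_c * (S14o_b ^ k * f) = (-1) ^ k *\<^sub>C (S14o_b ^ k * (S14o_c * f))"
    "S14o_d * (S14o_b ^ k * f) = (-1) ^ k *\<^sub>C (S14o_b ^ k * (S14o_d * f))"
    "S14o_d * (S14o_c ^ k * f) = S14o_c ^ k * (S14o_d * f)" for k f
    by (simp_all add: rel scaleC_mult_left flip: mult.assoc)
  show "S14o_a * S14o_monomial k l m n = S14o_monomial (Suc k) l m n"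
    "S14o_b * S14o_monomial k l m n = S14o_monomial k (Suc l) m n"
    "S14o_c * S14o_monomial k l m n = (-1) ^ (k + l) *\<^sub>C S14o_monomial k l (Suc m) n"
    "S14o_d * S14o_monomial k l m n = (-1) ^ (k + l) *\<^sub>C S14o_monomial k l m (Suc n)"
    by (simp_all add: rel' mult.assoc power_add scaleC_mult_right)
qed

lemma S14o_eq_on_monomials:
  assumes "clinear F" "clinear G" "\<And>k l m n. F (S14o_monomial k l m n) = G (S14o_monomial k l m n)"
  shows "F f = G f"
proof -
  let ?M = "{S14o_monomial k l m n | k l m n. True}"
  have "f \<in> cvec.span ?M"
  proof (induction f rule: S14o_induct)
    case one
    have "1 = S14o_monomial 0 0 0 0" by simp
    then show ?case by (intro cvec.span_base) blast
  next
    case (gen x f)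
    from gen(2) show ?case
    proof (induction rule: cvec.span_induct_alt)
      case base
      show ?case by (simp add: cvec.span_zero)
    next
      case (step c y z)
      from step(1) obtain k l m n where y: "y = S14o_monomial k l m n" by blast
      have mono: "S14o_monomial k l m n \<in> cvec.span ?M" for k l m n
        by (intro cvec.span_base) blast
      have "x * y \<in> cvec.span ?M"
        using gen(1) unfolding y
        by (auto simp only: gen_mult_monomial insert_iff empty_iff intro!: cvec.span_scale mono)
      then show ?case
        using step(2) by (simp add: distrib_left scaleC_mult_right cvec.span_add cvec.span_scale)
    qed
  qed (auto intro: cvec.span_add cvec.span_scale)
  then show ?thesis
    by (induction rule: cvec.span_induct_alt)
      (auto simp: assms(3) clinear_0[OF assms(1)] clinear_0[OF assms(2)] clinear_add[OF assms(1)]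
        clinear_add[OF assms(2)] clinear_scale[OF assms(1)] clinear_scale[OF assms(2)])
qed

lemma word_exponents_append:
  "word_exponents (u @ v) = (case (word_exponents u, word_exponents v) of
    ((k, l, m, n), (k', l', m', n')) \<Rightarrow> (k + k', l + l', m + m', n + n'))"
  by (induction u) (auto split: prod.splits letter.splits)

lemma word_sign_append:
  assumes u: "word_exponents u = (k, l, m, n)" and v: "word_exponents v = (k', l', m', n')"
  shows "word_sign (u @ v) = (-1) ^ ((m + n) * (k' + l')) * word_sign u * word_sign v"
  using u
proof (induction u arbitrary: k l m n)
  case (Cons x u)
  obtain k1 l1 m1 n1 where u: "word_exponents u = (k1, l1, m1, n1)" by (cases "word_exponents u")
  have uv: "word_exponents (u @ v) = (k1 + k', l1 + l', m1 + m', n1 + n')"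
    by (simp add: word_exponents_append u v)
  note IH = Cons.IH[OF u]
  have *: "(-1) ^ (k1 + k' + (l1 + l')) = (-1) ^ (k1 + l1) * ((-1) ^ (k' + l') :: complex)"
    by (simp add: power_add)
  from Cons.prems show ?case
    by (cases x) (auto simp: u uv IH * power_add add_mult_distrib)
qed simp

definition functional_free :: "(nat \<Rightarrow> nat \<Rightarrow> nat \<Rightarrow> nat \<Rightarrow> complex) \<Rightarrow> free_algebra \<Rightarrow> complex"
  where "functional_free g = free_extend (\<lambda>w. case word_exponents (letters w) of
    (k, l, m, n) \<Rightarrow> word_sign (letters w) * g k l m n)"

lemma functional_free_word:
  "functional_free g (Poly_Mapping.single (Word w) c) =
    c * (case word_exponents w of (k, l, m, n) \<Rightarrow> word_sign w * g k l m n)"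
  by (simp add: functional_free_def)

lemma functional_free_swap:
  assumes "word_exponents (y # x # v) = word_exponents (x # y # v)"
    and "word_sign (y # x # v) = s * word_sign (x # y # v)"
  shows "functional_free g (Poly_Mapping.single (Word (u @ y # x # v)) c) =
    s * functional_free g (Poly_Mapping.single (Word (u @ x # y # v)) c)"
proof -
  obtain k l m n where u: "word_exponents u = (k, l, m, n)" by (cases "word_exponents u")
  obtain k' l' m' n' where v: "word_exponents (x # y # v) = (k', l', m', n')"
    by (cases "word_exponents (x # y # v)")
  show ?thesis
    unfolding functional_free_word word_exponents_append assms(1) v
      word_sign_append[OF u v] word_sign_append[OF u v[folded assms(1)]] assms(2)
    by (simp add: u)
qed

lemma functional_free_vanish:
  assumes "r \<in> S14o_relators"
  shows "functional_free g (p * r * q) = 0"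
proof -
  have lin: "clinear (functional_free g)"
    unfolding functional_free_def by (rule clinear_free_extend)
  show ?thesis
  proof (induction p rule: free_induct)
    case (single u c)
    show ?case
    proof (induction q rule: free_induct)
      case (single v d)
      define S where "S w = (Poly_Mapping.single (Word (letters u @ w @ letters v)) (c * d) :: free_algebra)" for w
      have gens: "Poly_Mapping.single u c * (free_gen y * free_gen x) * Poly_Mapping.single v d = S [y, x]" for x y
        by (simp add: S_def free_gen_def mult_single plus_word_def)
      obtain k l m n where v: "word_exponents (letters v) = (k, l, m, n)"
        by (cases "word_exponents (letters v)")
      have swap: "functional_free g (S [Lb, La]) = functional_free g (S [La, Lb])"
        "functional_free g (S [Lc, La]) = - functional_free g (S [La, Lc])"
        "functional_free g (S [Ld, La]) = - functional_free g (S [La, Ld])"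
        "functional_free g (S [Lc, Lb]) = - functional_free g (S [Lb, Lc])"
        "functional_free g (S [Ld, Lb]) = - functional_free g (S [Lb, Ld])"
        "functional_free g (S [Ld, Lc]) = functional_free g (S [Lc, Ld])"
        using functional_free_swap[of Lb La "letters v" 1 g "letters u" "c * d"]
          functional_free_swap[of Lc La "letters v" "-1" g "letters u" "c * d"]
          functional_free_swap[of Ld La "letters v" "-1" g "letters u" "c * d"]
          functional_free_swap[of Lc Lb "letters v" "-1" g "letters u" "c * d"]
          functional_free_swap[of Ld Lb "letters v" "-1" g "letters u" "c * d"]
          functional_free_swap[of Ld Lc "letters v" 1 g "letters u" "c * d"]
        by (simp_all add: S_def v)
      show ?case
        using assms unfolding S14o_relators_def Let_def
        by (auto simp: distrib_left distrib_right left_diff_distrib right_diff_distrib gens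
            clinear_add[OF lin] clinear_diff[OF lin] swap)
    qed (simp add: distrib_left clinear_add[OF lin])
  qed (simp add: distrib_right clinear_add[OF lin])
qed

lift_definition functional_aux :: "(nat \<Rightarrow> nat \<Rightarrow> nat \<Rightarrow> nat \<Rightarrow> complex) \<Rightarrow> S14o \<Rightarrow> complex"
  is functional_free
proof -
  fix g and p q :: free_algebra
  have lin: "clinear (functional_free g)"
    unfolding functional_free_def by (rule clinear_free_extend)
  assume "S14o_eq p q"
  then have "functional_free g (p - q) = 0"
    unfolding S14o_eq_def S14o_ideal_def
    by (rule clinear_vanish_span[OF lin, rotated]) (auto simp: functional_free_vanish)
  then show "functional_free g p = functional_free g q"
    by (simp add: clinear_diff[OF lin])
qed

lemma clinear_functional_aux: "clinear (functional_aux g)"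
proof (rule clinearI)
  have lin: "clinear (functional_free g)"
    unfolding functional_free_def by (rule clinear_free_extend)
  fix f f' c
  show "functional_aux g (f + f') = functional_aux g f + functional_aux g f'"
    by (induction f rule: S14o.abs_induct, induction f' rule: S14o.abs_induct)
      (simp add: functional_aux.abs_eq plus_S14o.abs_eq clinear_add[OF lin])
  show "functional_aux g (c *\<^sub>C f) = c *\<^sub>C functional_aux g f"
    by (induction f rule: S14o.abs_induct)
      (simp add: functional_aux.abs_eq scaleC_S14o.abs_eq clinear_scale[OF lin])
qed

lemma abs_free_gen_power:
  "abs_S14o (free_gen x) ^ k = abs_S14o (Poly_Mapping.single (Word (replicate k x)) 1)"
proof (induction k)
  case 0
  have "Poly_Mapping.single (Word []) 1 = (1 :: free_algebra)"
    by (simp add: zero_word_def[symmetric])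
  then show ?case by (simp add: one_S14o.abs_eq)
next
  case (Suc k)
  have "free_gen x * Poly_Mapping.single (Word (replicate k x)) 1 = Poly_Mapping.single (Word (replicate (Suc k) x)) 1"
    by (simp add: free_gen_def mult_single plus_word_def)
  then show ?case by (simp only: power_Suc Suc times_S14o.abs_eq)
qed

lemma functional_aux_monomial: "functional_aux g (S14o_monomial k l m n) = g k l m n"
proof -
  let ?w = "replicate k La @ replicate l Lb @ replicate m Lc @ replicate n Ld"
  have d: "word_exponents (replicate n Ld) = (0, 0, 0, n) \<and> word_sign (replicate n Ld) = 1"
    by (induction n) auto
  have c: "word_exponents (replicate m Lc @ replicate n Ld) = (0, 0, m, n) \<and>
      word_sign (replicate m Lc @ replicate n Ld) = 1"
    by (induction m) (auto simp: d)
  have b: "word_exponents (replicate l Lb @ replicate m Lc @ replicate n Ld) = (0, l, m, n) \<and>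
      word_sign (replicate l Lb @ replicate m Lc @ replicate n Ld) = 1"
    by (induction l) (auto simp: c)
  have a: "word_exponents ?w = (k, l, m, n) \<and> word_sign ?w = 1"
    by (induction k) (auto simp: b)
  have "S14o_monomial k l m n = abs_S14o (Poly_Mapping.single (Word ?w) 1)"
    by (simp add: S14o_a.abs_eq S14o_b.abs_eq S14o_c.abs_eq S14o_d.abs_eq abs_free_gen_power
        times_S14o.abs_eq mult_single plus_word_def)
  then show ?thesis
    using a by (simp add: functional_aux.abs_eq functional_free_word)
qed

text \<open>The ordered monomials form a basis: every assignment of values to them extends uniquely
  to a linear functional.\<close>

theorem S14o_basis:
  "\<exists>!\<phi>. clinear \<phi> \<and> (\<forall>k l m n. \<phi> (S14o_a ^ k * S14o_b ^ l * S14o_c ^ m * S14o_d ^ n) = g k l m n)"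
    for g :: "nat \<Rightarrow> nat \<Rightarrow> nat \<Rightarrow> nat \<Rightarrow> complex"
proof (rule ex1I[of _ "functional_aux g"])
  show "clinear (functional_aux g) \<and> (\<forall>k l m n. functional_aux g (S14o_monomial k l m n) = g k l m n)"
    by (simp add: clinear_functional_aux functional_aux_monomial)
  show "\<phi> = functional_aux g" if "clinear \<phi> \<and> (\<forall>k l m n. \<phi> (S14o_monomial k l m n) = g k l m n)" for \<phi>
  proof
    fix f
    show "\<phi> f = functional_aux g f"
      by (rule S14o_eq_on_monomials) (use that in \<open>simp_all add: clinear_functional_aux functional_aux_monomial\<close>)
  qed
qed

definition functional :: "(nat \<Rightarrow> nat \<Rightarrow> nat \<Rightarrow> nat \<Rightarrow> complex) \<Rightarrow> S14o \<Rightarrow> complex"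
  where "functional g = (THE \<phi>. clinear \<phi> \<and>
    (\<forall>k l m n. \<phi> (S14o_a ^ k * S14o_b ^ l * S14o_c ^ m * S14o_d ^ n) = g k l m n))"

lemma clinear_functional: "clinear (functional g)"
  and functional_monomial: "functional g (S14o_a ^ k * S14o_b ^ l * S14o_c ^ m * S14o_d ^ n) = g k l m n"
  using theI'[OF S14o_basis[of g]] by (auto simp: functional_def)

definition functional_A :: "S14o \<Rightarrow> complex"
  where "functional_A = functional (\<lambda>k l m n. if l = 0 \<and> m = 0 \<and> n = 0 then of_nat k else 0)"

definition functional_B :: "S14o \<Rightarrow> complex"
  where "functional_B = functional (\<lambda>k l m n. if l = 1 \<and> m = 0 \<and> n = 0 then 1 else 0)"

definition functional_C :: "S14o \<Rightarrow> complex"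
  where "functional_C = functional (\<lambda>k l m n. if l = 0 \<and> m = 1 \<and> n = 0 then 1 else 0)"

definition functional_D :: "S14o \<Rightarrow> complex"
  where "functional_D = functional (\<lambda>k l m n. if l = 0 \<and> m = 0 \<and> n = 1 then 1 else 0)"

definition functional_K :: "S14o \<Rightarrow> complex"
  where "functional_K = functional (\<lambda>k l m n. if l = 0 \<and> m = 0 \<and> n = 0 then (-1) ^ k else 0)"

section \<open>The dual algebra s14o\<close>

definition functional_mult :: "(S14o \<Rightarrow> complex) \<Rightarrow> (S14o \<Rightarrow> complex) \<Rightarrow> S14o \<Rightarrow> complex"
  where "functional_mult u v f = tensor_lift (\<lambda>x y. u x * v y) (S14o_comul f)"

text \<open>The unital subalgebra of the dual generated by the functionals. The group-like \<open>K\<close> has to be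
  among the generators: the coproducts of \<open>C\<close> and \<open>D\<close> involve it.\<close>

inductive_set s14o_carrier :: "(S14o \<Rightarrow> complex) set" where
  A: "functional_A \<in> s14o_carrier"
| B: "functional_B \<in> s14o_carrier"
| C: "functional_C \<in> s14o_carrier"
| D: "functional_D \<in> s14o_carrier"
| K: "functional_K \<in> s14o_carrier"
| one: "S14o_counit \<in> s14o_carrier"
| add: "u \<in> s14o_carrier \<Longrightarrow> v \<in> s14o_carrier \<Longrightarrow> (\<lambda>f. u f + v f) \<in> s14o_carrier"
| scale: "u \<in> s14o_carrier \<Longrightarrow> (\<lambda>f. c * u f) \<in> s14o_carrier"
| mult: "u \<in> s14o_carrier \<Longrightarrow> v \<in> s14o_carrier \<Longrightarrow> functional_mult u v \<in> s14o_carrier"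

lemma cbilinear_functional_mult:
  fixes u :: "'a::complex_vector \<Rightarrow> complex" and v :: "'b::complex_vector \<Rightarrow> complex"
  assumes "clinear u" "clinear v"
  shows "cbilinear (\<lambda>x y. u x * v y)"
  by (rule cbilinear_compose[OF cbilinear_mult assms])

lemma tensor_lift_fun_mult:
  fixes c :: complex
  shows "tensor_lift (\<lambda>x y. c * B x y) t = c * tensor_lift B t"
  by (simp add: tensor_lift_def free_extend_def case_prod_beta sum_distrib_left mult.left_commute)

lemma s14o_carrier_linear: "u \<in> s14o_carrier \<Longrightarrow> clinear u"
proof (induction rule: s14o_carrier.induct)
  case (mult u v)
  have "clinear (\<lambda>f. tensor_lift (\<lambda>x y. u x * v y) (S14o_comul f))"
    using mult by (intro clinear_compose[OF clinear_tensor_lift] cbilinear_functional_mult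
        algebra_homD(1)[OF algebra_hom_S14o_comul])
  then show ?case unfolding functional_mult_def[abs_def] .
next
  case (scale u c)
  show ?case
    by (rule clinearI) (simp_all add: clinear_add[OF scale(2)] clinear_scale[OF scale(2)] algebra_simps)
qed (auto simp: functional_A_def functional_B_def functional_C_def functional_D_def functional_K_def
    clinear_functional clinear_plus algebra_homD(1)[OF algebra_hom_S14o_counit])

lemma functional_mult_assoc:
  assumes u: "clinear u" and v: "clinear v" and w: "clinear w"
  shows "functional_mult (functional_mult u v) w f = functional_mult u (functional_mult v w) f"
proof -
  note lin = clinear_tensor_lift[OF cbilinear_functional_mult]
  note \<delta> = algebra_homD(1)[OF algebra_hom_S14o_comul]
  let ?T = "\<lambda>x t. u x * tensor_lift (\<lambda>y z. v y * w z) t"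
  have T: "cbilinear ?T"
    by (rule cbilinear_functional_mult[OF u lin[OF v w]])
  have uv: "cbilinear (\<lambda>x y. u x * v y)" and vw: "cbilinear (\<lambda>x y. v x * w y)"
    using u v w by (simp_all add: cbilinear_functional_mult)
  have 1: "tensor_lift (\<lambda>s z. tensor_lift (\<lambda>x y. u x * v y) s * w z) t = tensor_lift ?T (tensor_assoc t)"
    (is "?F t = ?G t") for t
  proof (rule clinear_tensor_eqI[where f = ?F and g = ?G])
    have L: "cbilinear (\<lambda>s z. tensor_lift (\<lambda>x y. u x * v y) s * w z)"
      by (rule cbilinear_functional_mult[OF lin[OF u v] w])
    then show "clinear ?F" by (rule clinear_tensor_lift)
    show "clinear ?G"
      by (rule clinear_compose[OF clinear_tensor_lift[OF T] clinear_tensor_assoc])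
    fix s z
    show "?F (s \<otimes> z) = ?G (s \<otimes> z)"
    proof (induction s rule: tensor_induct)
      case (pure x y)
      show ?case using L T uv vw by (simp add: mult.assoc)
    next
      case (add s s')
      then show ?case
        by (simp add: tensor_add_left tensor_lift_add[OF L] tensor_lift_add[OF T]
            clinear_add[OF clinear_tensor_assoc])
    qed
  qed
  have "functional_mult (functional_mult u v) w f =
      tensor_lift (\<lambda>s z. tensor_lift (\<lambda>x y. u x * v y) s * w z) (tensor_map S14o_comul id (S14o_comul f))"
    unfolding functional_mult_def
    by (subst tensor_lift_tensor_map[OF cbilinear_functional_mult[OF lin[OF u v] w] \<delta> clinear_ident(2)]) simp
  also have "\<dots> = tensor_lift ?T (tensor_map id S14o_comul (S14o_comul f))"
    by (simp add: 1 S14o_coassoc)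
  also have "\<dots> = functional_mult u (functional_mult v w) f"
    unfolding functional_mult_def
    by (subst tensor_lift_tensor_map[OF T clinear_ident(2) \<delta>]) simp
  finally show ?thesis .
qed

lemma functional_mult_counit:
  assumes u: "clinear u"
  shows "functional_mult S14o_counit u f = u f" "functional_mult u S14o_counit f = u f"
proof -
  note e = algebra_homD(1)[OF algebra_hom_S14o_counit]
  have B: "cbilinear (\<lambda>x y. S14o_counit x *\<^sub>C (y::S14o))" "cbilinear (\<lambda>x y. S14o_counit y *\<^sub>C (x::S14o))"
    by (rule cbilinearI; simp add: clinear_add[OF e] clinear_scale[OF e] scaleC_add_left
        scaleC_add_right mult.commute)+
  have 1: "tensor_lift (\<lambda>x y. S14o_counit x * u y) t = u (tensor_lift (\<lambda>x y. S14o_counit x *\<^sub>C y) t)" for t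
    by (rule clinear_tensor_eqI[OF clinear_tensor_lift[OF cbilinear_functional_mult[OF e u]]
          clinear_compose[OF u clinear_tensor_lift[OF B(1)]]])
      (simp add: B cbilinear_functional_mult[OF e u] clinear_scale[OF u])
  have 2: "tensor_lift (\<lambda>x y. u x * S14o_counit y) t = u (tensor_lift (\<lambda>x y. S14o_counit y *\<^sub>C x) t)" for t
    by (rule clinear_tensor_eqI[OF clinear_tensor_lift[OF cbilinear_functional_mult[OF u e]]
          clinear_compose[OF u clinear_tensor_lift[OF B(2)]]])
      (simp add: B cbilinear_functional_mult[OF u e] clinear_scale[OF u])
  show "functional_mult S14o_counit u f = u f"
    by (simp add: functional_mult_def 1 S14o_counit_left)
  show "functional_mult u S14o_counit f = u f"
    by (simp add: functional_mult_def 2 S14o_counit_right)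
qed

typedef s14o = s14o_carrier
  using s14o_carrier.one by blast

setup_lifting type_definition_s14o

instantiation s14o :: complex_algebra
begin
lift_definition zero_s14o :: s14o is "\<lambda>_. 0"
  using s14o_carrier.scale[OF s14o_carrier.one, of 0] by simp
lift_definition one_s14o :: s14o is S14o_counit
  by (rule s14o_carrier.one)
lift_definition plus_s14o :: "s14o \<Rightarrow> s14o \<Rightarrow> s14o" is "\<lambda>u v f. u f + v f"
  by (rule s14o_carrier.add)
lift_definition uminus_s14o :: "s14o \<Rightarrow> s14o" is "\<lambda>u f. - u f"
  using s14o_carrier.scale[of _ "-1"] by simp
lift_definition minus_s14o :: "s14o \<Rightarrow> s14o \<Rightarrow> s14o" is "\<lambda>u v f. u f - v f"
  using s14o_carrier.add[OF _ s14o_carrier.scale[of _ "-1"]] by simp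
lift_definition scaleC_s14o :: "complex \<Rightarrow> s14o \<Rightarrow> s14o" is "\<lambda>c u f. c * u f"
  by (rule s14o_carrier.scale)
lift_definition times_s14o :: "s14o \<Rightarrow> s14o \<Rightarrow> s14o" is functional_mult
  by (rule s14o_carrier.mult)
instance
proof
  fix u v w :: s14o and c d :: complex
  show "u + v + w = u + (v + w)" "u + v = v + u" "0 + u = u" "- u + u = 0" "u - v = u + - v"
    "c *\<^sub>C (u + v) = c *\<^sub>C u + c *\<^sub>C v" "(c + d) *\<^sub>C u = c *\<^sub>C u + d *\<^sub>C u"
    "c *\<^sub>C d *\<^sub>C u = (c * d) *\<^sub>C u" "1 *\<^sub>C u = u"
    by (transfer; simp add: algebra_simps fun_eq_iff)+
  show "u * v * w = u * (v * w)"
    by transfer (simp add: fun_eq_iff functional_mult_assoc s14o_carrier_linear)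
  show "1 * u = u" "u * 1 = u"
    by (transfer; simp add: fun_eq_iff functional_mult_counit s14o_carrier_linear)+
  show "(u + v) * w = u * w + v * w" "u * (v + w) = u * v + u * w"
    by (transfer; simp add: fun_eq_iff functional_mult_def tensor_lift_fun_add distrib_left distrib_right)+
  show "(c *\<^sub>C u) * v = c *\<^sub>C (u * v)"
    by transfer (simp add: fun_eq_iff functional_mult_def mult.assoc
        tensor_lift_fun_mult)
  show "u * (c *\<^sub>C v) = c *\<^sub>C (u * v)"
    by transfer (simp add: fun_eq_iff functional_mult_def mult.left_commute
        tensor_lift_fun_mult)
qed
end

lift_definition s14o_A :: s14o is functional_A by (rule s14o_carrier.A)
lift_definition s14o_B :: s14o is functional_B by (rule s14o_carrier.B)
lift_definition s14o_C :: s14o is functional_C by (rule s14o_carrier.C)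
lift_definition s14o_D :: s14o is functional_D by (rule s14o_carrier.D)
lift_definition s14o_K :: s14o is functional_K by (rule s14o_carrier.K)

text \<open>The pairing of s14o with S14o, and the induced pairing of their tensor squares.\<close>

definition pairing :: "s14o \<Rightarrow> S14o \<Rightarrow> complex"
  where "pairing = Rep_s14o"

definition pairing2 :: "(s14o, s14o) tensor \<Rightarrow> (S14o, S14o) tensor \<Rightarrow> complex"
  where "pairing2 t = tensor_lift (\<lambda>f g. tensor_lift (\<lambda>u v. pairing u f * pairing v g) t)"

lemma cbilinear_pairing: "cbilinear pairing"
proof (rule cbilinearI)
  fix u v :: s14o and f g :: S14o and c
  show "pairing (u + v) f = pairing u f + pairing v f" "pairing (c *\<^sub>C u) f = c *\<^sub>C pairing u f"
    by (simp_all add: pairing_def plus_s14o.rep_eq scaleC_s14o.rep_eq)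
  show "pairing u (f + g) = pairing u f + pairing u g" "pairing u (c *\<^sub>C f) = c *\<^sub>C pairing u f"
    using clinear_add[of "pairing u"] clinear_scale[of "pairing u"] s14o_carrier_linear[OF Rep_s14o]
    by (auto simp: pairing_def)
qed

lemma pairing2_bilinear:
  "cbilinear (\<lambda>u v. pairing u f * pairing v g)"
  "cbilinear (\<lambda>f g. tensor_lift (\<lambda>u v. pairing u f * pairing v g) t)"
proof -
  note P = cbilinearD[OF cbilinear_pairing]
  show *: "cbilinear (\<lambda>u v. pairing u f * pairing v g)" for f g
    by (rule cbilinearI) (simp_all add: P algebra_simps)
  show "cbilinear (\<lambda>f g. tensor_lift (\<lambda>u v. pairing u f * pairing v g) t)"
    by (rule cbilinearI)
      (simp_all add: P distrib_left distrib_right mult.assoc mult.left_commute tensor_lift_fun_add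
        tensor_lift_fun_mult)
qed

lemma pairing2_tensor [simp]: "pairing2 (u \<otimes> v) (f \<otimes> g) = pairing u f * pairing v g"
  unfolding pairing2_def tensor_lift_tensor[OF pairing2_bilinear(2)]
  by (rule tensor_lift_tensor[OF pairing2_bilinear(1)])

lemma pairing_mult: "pairing (u * v) f = pairing2 (u \<otimes> v) (S14o_comul f)"
proof -
  have "pairing2 (u \<otimes> v) = tensor_lift (\<lambda>f g. pairing u f * pairing v g)"
    by (simp add: pairing2_def pairing2_bilinear)
  then show ?thesis by (simp add: pairing_def times_s14o.rep_eq functional_mult_def)
qed

lemma pairing_one: "pairing 1 f = S14o_counit f"
  by (simp add: pairing_def one_s14o.rep_eq)

text \<open>The coproduct takes values in the algebraic tensor square of s14o itself, not merely in the
  dual of \<open>S14o \<otimes> S14o\<close>.\<close>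

definition dual_coproduct :: "s14o \<Rightarrow> (s14o, s14o) tensor \<Rightarrow> bool"
  where "dual_coproduct u t \<longleftrightarrow> (\<forall>f g. pairing u (f * g) = pairing2 t (f \<otimes> g))"

definition s14o_comul :: "s14o \<Rightarrow> (s14o, s14o) tensor"
  where "s14o_comul u = (THE t. dual_coproduct u t)"

definition s14o_counit :: "s14o \<Rightarrow> complex"
  where "s14o_counit u = pairing u 1"

end

theory Submission
  imports Defs "HOL-Computational_Algebra.Polynomial"
begin

text \<open>The generators are skew-primitive or group-like functionals on S14o, so identities between them
  need only be checked on \<open>a\<close>, \<open>b\<close>, \<open>c\<close>, \<open>d\<close>. The difficulty is that the antipode must be
  well defined on the concrete algebra of functionals. S14o itself has no antipode, because its
  central group-like quantum determinant \<open>det\<close> is not invertible; but for every \<open>k \<ge> 0\<close> there is a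
  bialgebra anti-endomorphism \<open>T\<^sub>k\<close> of S14o sending \<open>a\<close>, \<open>b\<close>, \<open>c\<close>, \<open>d\<close> to \<open>det\<^sup>k\<close> times
  \<open>a\<close>, \<open>-b\<close>, \<open>c\<close>, \<open>d\<close>. For \<open>u\<close> in s14o and fixed \<open>f\<close> the number \<open>u (T\<^sub>k f)\<close> is a polynomial
  in \<open>k\<close>, and its value at \<open>k = -1\<close> is \<open>(\<gamma> u) f\<close>.\<close>

section \<open>Skew derivations of S14o\<close>

text \<open>Puts the counit into the coefficient form of the other functionals, so that
  \<open>functional_mult_gen\<close> applies with the counit in the role of \<open>g\<close> or
  \<open>h\<close>.\<close>

lemma S14o_counit_conv_functional:
  "S14o_counit = functional (\<lambda>k l m n. if l = 0 \<and> m = 0 \<and> n = 0 then 1 else 0)"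
proof
  fix f
  note e = algebra_homD[OF algebra_hom_S14o_counit]
  have pow: "S14o_counit (x ^ k) = S14o_counit x ^ k" for x k
    by (induction k) (simp_all add: e)
  show "S14o_counit f = functional (\<lambda>k l m n. if l = 0 \<and> m = 0 \<and> n = 0 then 1 else 0) f"
    by (rule S14o_eq_on_monomials)
      (simp_all add: e clinear_functional functional_monomial pow)
qed

lemma functional_gens:
  "functional g 1 = g 0 0 0 0"
  "functional g S14o_a = g 1 0 0 0" "functional g S14o_b = g 0 1 0 0"
  "functional g S14o_c = g 0 0 1 0" "functional g S14o_d = g 0 0 0 1"
  using functional_monomial[of g 0 0 0 0] functional_monomial[of g 1 0 0 0]
    functional_monomial[of g 0 1 0 0] functional_monomial[of g 0 0 1 0] functional_monomial[of g 0 0 0 1]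
  by simp_all

text \<open>Induction on \<open>f\<close>: since \<open>g\<close> and \<open>h\<close> are
  multiplicative, the twisted Leibniz rule for a generator as left factor propagates to every left
  factor; \<open>u 1 = 0\<close> starts the induction.\<close>

lemma skew_derivation_mult:
  fixes u g h :: "S14o \<Rightarrow> complex"
  assumes u: "clinear u" and g: "algebra_hom g" and h: "algebra_hom h" and one: "u 1 = 0"
    and gen: "\<And>x f. x \<in> {S14o_a, S14o_b, S14o_c, S14o_d} \<Longrightarrow> u (x * f) = u x * g f + h x * u f"
  shows "u (f * f') = u f * g f' + h f * u f'"
proof (induction f rule: S14o_induct)
  case one
  show ?case by (simp add: \<open>u 1 = 0\<close> algebra_homD[OF h])
next
  case (gen x f)
  then show ?case
    by (simp only: mult.assoc assms(5)) (simp add: algebra_homD[OF g] algebra_homD[OF h] algebra_simps)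
next
  case (add f1 f2)
  then show ?case
    by (simp add: distrib_left distrib_right clinear_add[OF u] clinear_add[OF algebra_homD(1)[OF h]])
next
  case (scale c f)
  then show ?case
    by (simp add: scaleC_mult_left clinear_scale[OF u] clinear_scale[OF algebra_homD(1)[OF h]] algebra_simps)
qed

lemma functional_gen_monomial:
  "functional g (S14o_a * S14o_monomial k l m n) = g (Suc k) l m n"
  "functional g (S14o_b * S14o_monomial k l m n) = g k (Suc l) m n"
  "functional g (S14o_c * S14o_monomial k l m n) = (-1) ^ (k + l) * g k l (Suc m) n"
  "functional g (S14o_d * S14o_monomial k l m n) = (-1) ^ (k + l) * g k l m (Suc n)"
  unfolding gen_mult_monomial clinear_scale[OF clinear_functional] functional_monomial by simp_all

text \<open>A generator times an ordered monomial is the monomial with one exponent raised, up to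
  the sign \<open>(-1) ^ (k + l)\<close> for \<open>c\<close> and \<open>d\<close>. The Leibniz rule
  thus becomes four identities between coefficient functions.\<close>

lemma functional_mult_gen:
  assumes "x \<in> {S14o_a, S14o_b, S14o_c, S14o_d}"
    and "\<And>k l m n. u (Suc k) l m n = u 1 0 0 0 * g k l m n + h 1 0 0 0 * u k l m n"
    and "\<And>k l m n. u k (Suc l) m n = u 0 1 0 0 * g k l m n + h 0 1 0 0 * u k l m n"
    and "\<And>k l m n. (-1) ^ (k + l) * u k l (Suc m) n = u 0 0 1 0 * g k l m n + h 0 0 1 0 * u k l m n"
    and "\<And>k l m n. (-1) ^ (k + l) * u k l m (Suc n) = u 0 0 0 1 * g k l m n + h 0 0 0 1 * u k l m n"
  shows "functional u (x * f) = functional u x * functional g f + functional h x * functional u f"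
proof (rule S14o_eq_on_monomials)
  show "clinear (\<lambda>f. functional u (x * f))"
    by (rule clinearI) (simp_all add: distrib_left scaleC_mult_right
        clinear_add[OF clinear_functional] clinear_scale[OF clinear_functional])
  show "clinear (\<lambda>f. functional u x * functional g f + functional h x * functional u f)"
    by (rule clinearI) (simp_all add: algebra_simps
        clinear_add[OF clinear_functional] clinear_scale[OF clinear_functional])
  fix k l m n
  show "functional u (x * S14o_monomial k l m n) =
      functional u x * functional g (S14o_monomial k l m n) + functional h x * functional u (S14o_monomial k l m n)"
    unfolding functional_monomial using assms(1)
    by (elim insertE; hypsubst?) (simp_all only: functional_gen_monomial functional_gens assms(2-) empty_iff)
qed

lemma algebra_hom_functional_K: "algebra_hom functional_K"
proof -
  let ?g = "\<lambda>k l m n. if l = 0 \<and> m = 0 \<and> n = (0::nat) then (-1) ^ k else 0"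
  \<comment> \<open>With \<open>u = g\<close> and \<open>h = 0\<close> the twisted Leibniz rule is
    plain multiplicativity.\<close>
  have gen: "functional_K (x * f) = functional_K x * functional_K f"
    if "x \<in> {S14o_a, S14o_b, S14o_c, S14o_d}" for x f
    using functional_mult_gen[OF that, of ?g ?g "\<lambda>_ _ _ _. 0" f] that
    by (auto simp: functional_K_def functional_gens)
  have lin: "clinear functional_K"
    by (simp add: functional_K_def clinear_functional)
  have one: "functional_K 1 = 1"
    by (simp add: functional_K_def functional_gens)
  have "functional_K (f * g) = functional_K f * functional_K g" for f g
    by (induction f rule: S14o_induct)
      (simp_all only: gen mult.assoc one distrib_left distrib_right scaleC_mult_left
        clinear_add[OF lin] clinear_scale[OF lin] scaleC_complex mult_1)
  with lin one show ?thesis by (simp add: algebra_hom_def)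
qed

text \<open>The twist by \<open>K\<close> for \<open>C\<close> and \<open>D\<close> is a reordering
  sign: moving \<open>c\<close> or \<open>d\<close> to the right past \<open>a ^ k\<close> costs
  \<open>(-1) ^ k\<close>, the value of \<open>K\<close> there. These rules are the coproducts of
  the generators read through the pairing.\<close>

lemma functionals_mult:
  "functional_A (f * g) = functional_A f * S14o_counit g + S14o_counit f * functional_A g"
  "functional_B (f * g) = functional_B f * S14o_counit g + S14o_counit f * functional_B g"
  "functional_C (f * g) = functional_C f * functional_K g + S14o_counit f * functional_C g"
  "functional_D (f * g) = functional_D f * functional_K g + S14o_counit f * functional_D g"
  "functional_K (f * g) = functional_K f * functional_K g"
proof -
  note hom = algebra_hom_functional_K algebra_hom_S14o_counit
  note defs = functional_A_def functional_B_def functional_C_def functional_D_def functional_K_def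
    S14o_counit_conv_functional
  show "functional_K (f * g) = functional_K f * functional_K g"
    by (rule algebra_homD(3)[OF hom(1)])
  show "functional_A (f * g) = functional_A f * S14o_counit g + S14o_counit f * functional_A g"
    by (rule skew_derivation_mult; (fact hom)?; unfold defs; (rule clinear_functional functional_mult_gen)?)
      (auto simp: functional_gens)
  show "functional_B (f * g) = functional_B f * S14o_counit g + S14o_counit f * functional_B g"
    by (rule skew_derivation_mult; (fact hom)?; unfold defs; (rule clinear_functional functional_mult_gen)?)
      (auto simp: functional_gens)
  show "functional_C (f * g) = functional_C f * functional_K g + S14o_counit f * functional_C g"
    by (rule skew_derivation_mult; (fact hom)?; unfold defs; (rule clinear_functional functional_mult_gen)?)
      (auto simp: functional_gens)
  show "functional_D (f * g) = functional_D f * functional_K g + S14o_counit f * functional_D g"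
    by (rule skew_derivation_mult; (fact hom)?; unfold defs; (rule clinear_functional functional_mult_gen)?)
      (auto simp: functional_gens)
qed

section \<open>The coproduct of s14o\<close>

lemma clinear_pairing: "clinear (pairing u)"
  using cbilinear_pairing by (simp add: cbilinear_def)

lemma pairing_eqI: "(\<And>f. pairing u f = pairing v f) \<Longrightarrow> u = v"
  by (metis pairing_def Rep_s14o_inject ext)

lemma pairing_left [simp]:
  "pairing 0 f = 0" "pairing (u + v) f = pairing u f + pairing v f"
  "pairing (u - v) f = pairing u f - pairing v f" "pairing (- u) f = - pairing u f"
  "pairing (c *\<^sub>C u) f = c * pairing u f"
  by (simp_all add: pairing_def zero_s14o.rep_eq plus_s14o.rep_eq minus_s14o.rep_eq
      uminus_s14o.rep_eq scaleC_s14o.rep_eq)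

lemma pairing_gens:
  "pairing s14o_A = functional_A" "pairing s14o_B = functional_B" "pairing s14o_C = functional_C"
  "pairing s14o_D = functional_D" "pairing s14o_K = functional_K" "pairing 1 = S14o_counit"
  by (simp_all add: pairing_def s14o_A.rep_eq s14o_B.rep_eq s14o_C.rep_eq s14o_D.rep_eq
      s14o_K.rep_eq one_s14o.rep_eq)

lemma pairing_values [simp]:
  "pairing s14o_A 1 = 0" "pairing s14o_A S14o_a = 1" "pairing s14o_A S14o_b = 0"
  "pairing s14o_A S14o_c = 0" "pairing s14o_A S14o_d = 0"
  "pairing s14o_B 1 = 0" "pairing s14o_B S14o_a = 0" "pairing s14o_B S14o_b = 1"
  "pairing s14o_B S14o_c = 0" "pairing s14o_B S14o_d = 0"
  "pairing s14o_C 1 = 0" "pairing s14o_C S14o_a = 0" "pairing s14o_C S14o_b = 0"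
  "pairing s14o_C S14o_c = 1" "pairing s14o_C S14o_d = 0"
  "pairing s14o_D 1 = 0" "pairing s14o_D S14o_a = 0" "pairing s14o_D S14o_b = 0"
  "pairing s14o_D S14o_c = 0" "pairing s14o_D S14o_d = 1"
  "pairing s14o_K 1 = 1" "pairing s14o_K S14o_a = -1" "pairing s14o_K S14o_b = 0"
  "pairing s14o_K S14o_c = 0" "pairing s14o_K S14o_d = 0"
  "pairing 1 1 = 1" "pairing 1 S14o_a = 1" "pairing 1 S14o_b = 0"
  "pairing 1 S14o_c = 0" "pairing 1 S14o_d = 0"
  by (simp_all add: pairing_gens functional_A_def functional_B_def functional_C_def
      functional_D_def functional_K_def functional_gens algebra_homD(2)[OF algebra_hom_S14o_counit])

lemma pairing_gens_mult:
  "pairing s14o_A (f * g) = pairing s14o_A f * pairing 1 g + pairing 1 f * pairing s14o_A g"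
  "pairing s14o_B (f * g) = pairing s14o_B f * pairing 1 g + pairing 1 f * pairing s14o_B g"
  "pairing s14o_C (f * g) = pairing s14o_C f * pairing s14o_K g + pairing 1 f * pairing s14o_C g"
  "pairing s14o_D (f * g) = pairing s14o_D f * pairing s14o_K g + pairing 1 f * pairing s14o_D g"
  "pairing s14o_K (f * g) = pairing s14o_K f * pairing s14o_K g"
  "pairing 1 (f * g) = pairing 1 f * pairing 1 g"
  by (simp_all add: pairing_gens functionals_mult algebra_homD(3)[OF algebra_hom_S14o_counit])

section \<open>The pairing of the tensor squares and its nondegeneracy\<close>

lemma clinear_pairing2: "clinear (pairing2 t)"
  unfolding pairing2_def by (rule clinear_tensor_lift[OF pairing2_bilinear(2)])

lemma pairing2_tensor_right:
  "pairing2 t (f \<otimes> g) = tensor_lift (\<lambda>u v. pairing u f * pairing v g) t"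
  unfolding pairing2_def by (simp add: pairing2_bilinear)

lemma pairing2_left:
  "pairing2 (s + t) (f \<otimes> g) = pairing2 s (f \<otimes> g) + pairing2 t (f \<otimes> g)"
  "pairing2 (c *\<^sub>C t) (f \<otimes> g) = c * pairing2 t (f \<otimes> g)"
  by (simp_all add: pairing2_tensor_right tensor_lift_add tensor_lift_scaleC pairing2_bilinear)

lemma pairing2_right:
  "pairing2 t (x + y) = pairing2 t x + pairing2 t y"
  "pairing2 t (x - y) = pairing2 t x - pairing2 t y"
  "pairing2 t (- x) = - pairing2 t x"
  "pairing2 t (c *\<^sub>C x) = c * pairing2 t x"
  by (simp_all add: clinear_add[OF clinear_pairing2] clinear_diff[OF clinear_pairing2]
      clinear_minus[OF clinear_pairing2] clinear_scale[OF clinear_pairing2])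

lemma tensor_zero_left [simp]: "0 \<otimes> y = 0" and tensor_zero_right [simp]: "x \<otimes> 0 = 0"
  using tensor_scaleC_left[of 0 0 y] tensor_scaleC_right[of x 0 0] by simp_all

lemma tensor_sum_right: "x \<otimes> sum g S = (\<Sum>i\<in>S. x \<otimes> g i)"
  by (induction S rule: infinite_finite_induct) (simp_all add: tensor_add_right)

lemma tensor_eq_sum: "\<exists>n u v. t = (\<Sum>i<(n::nat). u i \<otimes> v i)"
proof (induction t rule: tensor_induct)
  case (pure x y)
  have "x \<otimes> y = (\<Sum>i<Suc 0. x \<otimes> y)" by simp
  then show ?case by (intro exI)
next
  case (add s t)
  then obtain n m :: nat and u v u' v'
    where s: "s = (\<Sum>i<n. u i \<otimes> v i)" and t: "t = (\<Sum>i<m. u' i \<otimes> v' i)"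
    by (elim exE)
  let ?u = "\<lambda>i. if i < n then u i else u' (i - n)" and ?v = "\<lambda>i. if i < n then v i else v' (i - n)"
  have "(\<Sum>i<n + m. ?u i \<otimes> ?v i) = s + t"
    unfolding s t by (simp add: lessThan_atLeast0 sum.atLeastLessThan_concat[symmetric, of 0 n "n + m"]
        sum.atLeastLessThan_shift_0[of _ n "n + m"])
  then show ?case by metis
qed

text \<open>Induction on the length of the tensor: if some \<open>u n\<close> does not vanish at \<open>f\<^sub>0\<close>, evaluating at
  \<open>f\<^sub>0\<close> expresses \<open>v n\<close> through the other \<open>v i\<close>, which shortens the sum.\<close>

lemma sum_tensor_eq_0:
  fixes u v :: "nat \<Rightarrow> s14o"
  assumes "\<And>f g. (\<Sum>i<n. pairing (u i) f * pairing (v i) g) = 0"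
  shows "(\<Sum>i<n. u i \<otimes> v i) = 0"
  using assms
proof (induction n arbitrary: u)
  case (Suc n)
  show ?case
  proof (cases "u n = 0")
    case True
    with Suc show ?thesis by simp
  next
    case False
    then obtain f\<^sub>0 where f\<^sub>0: "pairing (u n) f\<^sub>0 \<noteq> 0"
      using pairing_eqI[of "u n" 0] by auto
    define c where "c i = - pairing (u i) f\<^sub>0 / pairing (u n) f\<^sub>0" for i
    have vn: "v n = (\<Sum>i<n. c i *\<^sub>C v i)"
    proof (rule pairing_eqI)
      fix g
      have "pairing (\<Sum>i<n. c i *\<^sub>C v i) g = (\<Sum>i<n. c i * pairing (v i) g)"
        by (induction n) simp_all
      also have "\<dots> = - (\<Sum>i<n. pairing (u i) f\<^sub>0 * pairing (v i) g) / pairing (u n) f\<^sub>0"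
        by (simp add: c_def sum_divide_distrib sum_negf)
      also have "\<dots> = pairing (v n) g"
        using Suc.prems[of f\<^sub>0 g] f\<^sub>0 by (simp add: field_simps add_eq_0_iff)
      finally show "pairing (v n) g = pairing (\<Sum>i<n. c i *\<^sub>C v i) g" by simp
    qed
    have "(\<Sum>i<n. (u i + c i *\<^sub>C u n) \<otimes> v i) = 0"
    proof (rule Suc.IH)
      fix f g
      have "pairing (v n) g = (\<Sum>i<n. c i * pairing (v i) g)"
        unfolding vn by (induction n) simp_all
      then show "(\<Sum>i<n. pairing (u i + c i *\<^sub>C u n) f * pairing (v i) g) = 0"
        using Suc.prems[of f g]
        by (simp add: distrib_right sum.distrib sum_distrib_left mult.assoc mult.left_commute)
    qed
    then show ?thesis
      by (simp add: vn tensor_add_left tensor_scaleC_left tensor_sum_right tensor_scaleC_right sum.distrib)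
  qed
qed simp

text \<open>This embeds the algebraic tensor square of s14o into the bilinear forms on S14o, which
  is what makes the coproduct unique.\<close>

lemma pairing2_nondegenerate:
  assumes "\<And>f g. pairing2 t (f \<otimes> g) = 0"
  shows "t = 0"
proof -
  obtain n u v where t: "t = (\<Sum>i<(n::nat). u i \<otimes> v i)"
    using tensor_eq_sum by blast
  have "pairing2 t (f \<otimes> g) = (\<Sum>i<n. pairing (u i) f * pairing (v i) g)" for f g
    unfolding t pairing2_tensor_right
    by (simp add: clinear_sum[OF clinear_tensor_lift[OF pairing2_bilinear(1)]] pairing2_bilinear)
  with assms show ?thesis
    using sum_tensor_eq_0 t by simp
qed

section \<open>Uniqueness and existence of the dual coproduct\<close>

lemma dual_coproduct_unique:
  assumes "dual_coproduct u s" "dual_coproduct u t"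
  shows "s = t"
proof -
  have "pairing2 (s + (-1) *\<^sub>C t) (f \<otimes> g) = 0" for f g
    using assms unfolding pairing2_left by (simp add: dual_coproduct_def)
  then show ?thesis
    using pairing2_nondegenerate by fastforce
qed

lemma dual_coproduct_add:
  "dual_coproduct u s \<Longrightarrow> dual_coproduct v t \<Longrightarrow> dual_coproduct (u + v) (s + t)"
  and dual_coproduct_scaleC: "dual_coproduct u s \<Longrightarrow> dual_coproduct (c *\<^sub>C u) (c *\<^sub>C s)"
  by (simp_all add: dual_coproduct_def pairing2_left)

lemma pairing2_pure: "pairing2 (u \<otimes> v) = tensor_lift (\<lambda>f g. pairing u f * pairing v g)"
  by (simp add: pairing2_def pairing2_bilinear)

text \<open>The product of the tensor square is convolution along the coproducts of both arguments.
  For \<open>s\<close> and \<open>t\<close> dual to \<open>u\<close> and \<open>v\<close>, the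
  double sum is the one in \<open>pairing2_mult_right\<close> with \<open>F\<close> and
  \<open>G\<close> the coproducts of \<open>f\<close> and \<open>g\<close>.\<close>

lemma pairing2_mult_left:
  "pairing2 (s * t) (f \<otimes> g) =
    tensor_lift (\<lambda>f1 f2. tensor_lift (\<lambda>g1 g2. pairing2 s (f1 \<otimes> g1) * pairing2 t (f2 \<otimes> g2))
      (S14o_comul g)) (S14o_comul f)"
proof (induction s rule: tensor_induct)
  case (pure u1 u2)
  show ?case
  proof (induction t rule: tensor_induct)
    case (pure v1 v2)
    \<comment> \<open>The factors evaluated at \<open>f1\<close> and \<open>f2\<close> are constants
      for the inner sum; regrouping lets them be pulled out.\<close>
    have "tensor_lift (\<lambda>g1 g2. pairing u1 f1 * pairing u2 g1 * (pairing v1 f2 * pairing v2 g2)) G =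
        pairing2 (u2 \<otimes> v2) G * (pairing u1 f1 * pairing v1 f2)" for f1 f2 G
    proof -
      have "tensor_lift (\<lambda>g1 g2. pairing u1 f1 * pairing u2 g1 * (pairing v1 f2 * pairing v2 g2)) G =
          tensor_lift (\<lambda>g1 g2. (pairing u1 f1 * pairing v1 f2) * (pairing u2 g1 * pairing v2 g2)) G"
        by (simp add: mult_ac)
      also have "\<dots> = (pairing u1 f1 * pairing v1 f2) * pairing2 (u2 \<otimes> v2) G"
        by (simp only: tensor_lift_fun_mult pairing2_pure)
      finally show ?thesis by simp
    qed
    moreover have "tensor_lift (\<lambda>f1 f2. pairing2 (u2 \<otimes> v2) G * (pairing u1 f1 * pairing v1 f2)) F =
        pairing2 (u2 \<otimes> v2) G * pairing2 (u1 \<otimes> v1) F" for F G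
      by (simp only: tensor_lift_fun_mult pairing2_pure)
    ultimately show ?case
      by (simp add: pairing_mult mult.commute)
  next
    case (add t t')
    then show ?case
      by (simp add: distrib_left pairing2_left tensor_lift_fun_add del: pairing2_tensor)
  qed
next
  case (add s s')
  then show ?case
    by (simp add: distrib_right pairing2_left tensor_lift_fun_add)
qed

lemma pairing2_mult_right:
  "pairing2 (u \<otimes> v) (F * G) =
    tensor_lift (\<lambda>f1 f2. tensor_lift (\<lambda>g1 g2. pairing u (f1 * g1) * pairing v (f2 * g2)) G) F"
proof -
  note P = cbilinearD[OF cbilinear_pairing]
  have L: "cbilinear (\<lambda>g1 g2. pairing u (f1 * g1) * pairing v (f2 * g2))" for f1 f2
    by (rule cbilinearI) (simp_all add: P distrib_left scaleC_mult_right algebra_simps)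
  have R: "cbilinear (\<lambda>f1 f2. tensor_lift (\<lambda>g1 g2. pairing u (f1 * g1) * pairing v (f2 * g2)) G)" for G
    by (rule cbilinearI) (simp_all add: P distrib_left distrib_right scaleC_mult_left mult.assoc
        mult.left_commute tensor_lift_fun_add tensor_lift_fun_mult)
  show ?thesis
  proof (induction F rule: tensor_induct)
    case (pure f1 f2)
    have "pairing2 (u \<otimes> v) ((f1 \<otimes> f2) * G) = tensor_lift (\<lambda>g1 g2. pairing u (f1 * g1) * pairing v (f2 * g2)) G"
      by (induction G rule: tensor_induct) (simp_all add: L distrib_left pairing2_right tensor_lift_add)
    then show ?case by (simp add: R)
  next
    case (add F F')
    then show ?case by (simp add: distrib_right pairing2_right tensor_lift_add R)
  qed
qed

text \<open>Duality turns multiplicativity of \<open>S14o_comul\<close> into multiplicativity of the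
  coproduct of s14o.\<close>

lemma dual_coproduct_mult:
  assumes "dual_coproduct u s" "dual_coproduct v t"
  shows "dual_coproduct (u * v) (s * t)"
  using assms
  by (simp add: dual_coproduct_def pairing_mult algebra_homD(3)[OF algebra_hom_S14o_comul]
      pairing2_mult_left pairing2_mult_right)

text \<open>Stands in for a presentation: s14o consists of concrete functionals, so maps out of it
  cannot be prescribed on generators. Coproduct and antipode are instead handled as relations, shown
  total by this induction and single-valued by nondegeneracy or interpolation.\<close>

lemma s14o_induct [case_names A B C D K one add scale mult]:
  assumes "P s14o_A" "P s14o_B" "P s14o_C" "P s14o_D" "P s14o_K" "P 1"
    and "\<And>u v. P u \<Longrightarrow> P v \<Longrightarrow> P (u + v)" "\<And>c u. P u \<Longrightarrow> P (c *\<^sub>C u)"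
    and "\<And>u v. P u \<Longrightarrow> P v \<Longrightarrow> P (u * v)"
  shows "P u"
proof -
  have "\<exists>v. Rep_s14o v = x \<and> P v" if "x \<in> s14o_carrier" for x
    using that
  proof (induction rule: s14o_carrier.induct)
    case (add x y)
    then show ?case using assms(7) plus_s14o.rep_eq by metis
  next
    case (scale x c)
    then show ?case using assms(8) scaleC_s14o.rep_eq by metis
  next
    case (mult x y)
    then show ?case using assms(9) times_s14o.rep_eq by metis
  qed (use assms(1-6) s14o_A.rep_eq s14o_B.rep_eq s14o_C.rep_eq s14o_D.rep_eq s14o_K.rep_eq
      one_s14o.rep_eq in blast)+
  from this[OF Rep_s14o] show ?thesis by (metis Rep_s14o_inject)
qed

lemma dual_coproduct_gens:
  "dual_coproduct s14o_A (s14o_A \<otimes> 1 + 1 \<otimes> s14o_A)"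
  "dual_coproduct s14o_B (s14o_B \<otimes> 1 + 1 \<otimes> s14o_B)"
  "dual_coproduct s14o_C (s14o_C \<otimes> s14o_K + 1 \<otimes> s14o_C)"
  "dual_coproduct s14o_D (s14o_D \<otimes> s14o_K + 1 \<otimes> s14o_D)"
  "dual_coproduct s14o_K (s14o_K \<otimes> s14o_K)"
  "dual_coproduct 1 (1 \<otimes> 1)"
  by (simp_all add: dual_coproduct_def pairing2_left pairing_gens_mult)

lemma dual_coproduct_exists: "\<exists>t. dual_coproduct u t"
  by (induction u rule: s14o_induct)
    (use dual_coproduct_gens dual_coproduct_add dual_coproduct_scaleC dual_coproduct_mult in blast)+

lemma dual_coproduct_ex1: "\<exists>!t. dual_coproduct u t"
  using dual_coproduct_exists dual_coproduct_unique by blast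

lemma dual_coproduct_comul: "dual_coproduct u (s14o_comul u)"
  unfolding s14o_comul_def by (rule theI'[OF dual_coproduct_ex1])

lemma s14o_comul_eqI: "dual_coproduct u t \<Longrightarrow> s14o_comul u = t"
  using dual_coproduct_comul dual_coproduct_unique by blast

lemmas s14o_comul_gens [simp] = dual_coproduct_gens[THEN s14o_comul_eqI]

section \<open>The bialgebra axioms for s14o\<close>

lemma algebra_hom_s14o_comul: "algebra_hom s14o_comul"
  unfolding algebra_hom_def
  by (intro conjI allI clinearI)
    (simp_all add: s14o_comul_eqI dual_coproduct_comul dual_coproduct_add dual_coproduct_scaleC
      dual_coproduct_mult one_tensor_def)

text \<open>Evaluation at \<open>1\<close> is multiplicative because \<open>1\<close> is group-like
  in S14o.\<close>

lemma algebra_hom_s14o_counit: "algebra_hom s14o_counit"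
  unfolding algebra_hom_def s14o_counit_def
  by (intro conjI allI clinearI)
    (simp_all add: pairing_mult algebra_homD(2)[OF algebra_hom_S14o_comul] one_tensor_def)

lemma s14o_counit_gens [simp]:
  "s14o_counit s14o_A = 0" "s14o_counit s14o_B = 0" "s14o_counit s14o_C = 0" "s14o_counit s14o_D = 0"
  "s14o_counit s14o_K = 1" "s14o_counit 1 = 1"
  by (simp_all add: s14o_counit_def)

lemma s14o_hom_eqI:
  assumes F: "algebra_hom F" and G: "algebra_hom G"
    and "F s14o_A = G s14o_A" "F s14o_B = G s14o_B" "F s14o_C = G s14o_C" "F s14o_D = G s14o_D"
    "F s14o_K = G s14o_K"
  shows "F u = G u"
  by (induction u rule: s14o_induct)
    (simp_all add: assms(3-) algebra_homD[OF F] algebra_homD[OF G] clinear_add[OF algebra_homD(1)[OF F]]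
      clinear_add[OF algebra_homD(1)[OF G]] clinear_scale[OF algebra_homD(1)[OF F]]
      clinear_scale[OF algebra_homD(1)[OF G]])

text \<open>Both sides are algebra homomorphisms, so the generators suffice; the counit laws are
  reduced in the same way.\<close>

lemma s14o_coassoc:
  "tensor_assoc (tensor_map s14o_comul id (s14o_comul u)) = tensor_map id s14o_comul (s14o_comul u)"
proof (rule s14o_hom_eqI)
  note hom = algebra_hom_s14o_comul algebra_hom_id
  show "algebra_hom (\<lambda>u. tensor_assoc (tensor_map s14o_comul id (s14o_comul u)))"
    by (rule algebra_hom_compose[OF algebra_hom_tensor_assoc algebra_hom_compose[OF algebra_hom_tensor_map]])
      (fact hom)+
  show "algebra_hom (\<lambda>u. tensor_map id s14o_comul (s14o_comul u))"
    by (rule algebra_hom_compose[OF algebra_hom_tensor_map]) (fact hom)+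
qed (insert algebra_homD(1)[OF algebra_hom_s14o_comul],
    simp_all add: clinear_add[OF clinear_tensor_map] clinear_add[OF clinear_tensor_assoc] clinear_ident
      tensor_add_left tensor_add_right)

lemma s14o_counit_left: "tensor_lift (\<lambda>x y. s14o_counit x *\<^sub>C y) (s14o_comul u) = u"
  and s14o_counit_right: "tensor_lift (\<lambda>x y. s14o_counit y *\<^sub>C x) (s14o_comul u) = u"
proof -
  note e = algebra_homD[OF algebra_hom_s14o_counit]
  have B: "cbilinear (\<lambda>x y. s14o_counit x *\<^sub>C (y::s14o))" "cbilinear (\<lambda>x y. s14o_counit y *\<^sub>C (x::s14o))"
    by (rule cbilinearI; simp add: clinear_add[OF e(1)] clinear_scale[OF e(1)] scaleC_add_left
        scaleC_add_right mult.commute)+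
  have hom: "algebra_hom (tensor_lift (\<lambda>x y. s14o_counit x *\<^sub>C (y::s14o)))"
    "algebra_hom (tensor_lift (\<lambda>x y. s14o_counit y *\<^sub>C (x::s14o)))"
    by (rule algebra_hom_tensorI;
        simp add: B clinear_tensor_lift e(2,3) scaleC_mult_left scaleC_mult_right mult.commute)+
  show "tensor_lift (\<lambda>x y. s14o_counit x *\<^sub>C y) (s14o_comul u) = u"
    by (rule s14o_hom_eqI[OF algebra_hom_compose[OF hom(1) algebra_hom_s14o_comul]
          algebra_hom_id[unfolded id_def]])
      (simp_all add: clinear_add[OF clinear_tensor_lift] B)
  show "tensor_lift (\<lambda>x y. s14o_counit y *\<^sub>C x) (s14o_comul u) = u"
    by (rule s14o_hom_eqI[OF algebra_hom_compose[OF hom(2) algebra_hom_s14o_comul]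
          algebra_hom_id[unfolded id_def]])
      (simp_all add: clinear_add[OF clinear_tensor_lift] B)
qed

lemma bialgebra_s14o: "bialgebra s14o_comul s14o_counit"
  unfolding bialgebra_def coalgebra_def
  using algebra_hom_s14o_comul algebra_hom_s14o_counit
  by (simp add: algebra_homD(1) s14o_coassoc s14o_counit_left s14o_counit_right)

section \<open>The relations of s14o\<close>

lemma pairing_mult_comul: "dual_coproduct u t \<Longrightarrow> pairing u (f * g) = pairing2 t (f \<otimes> g)"
  by (simp add: dual_coproduct_def)

text \<open>The coproduct formula is a recursion along left multiplication by generators of S14o, so
  \<open>u\<close> is determined by its values at \<open>1\<close>, \<open>a\<close>,
  \<open>b\<close>, \<open>c\<close>, \<open>d\<close>. The relations of s14o below, apart from
  \<open>K * K = 1\<close>, become such finite checks.\<close>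

lemma skew_primitive_eqI:
  assumes u: "s14o_comul u = u \<otimes> g + h \<otimes> u" and v: "s14o_comul v = v \<otimes> g + h \<otimes> v"
    and "pairing u 1 = pairing v 1"
    and gens: "pairing u S14o_a = pairing v S14o_a" "pairing u S14o_b = pairing v S14o_b"
      "pairing u S14o_c = pairing v S14o_c" "pairing u S14o_d = pairing v S14o_d"
  shows "u = v"
proof (rule pairing_eqI)
  fix f
  have *: "pairing w (x * f) = pairing w x * pairing g f + pairing h x * pairing w f"
    if "s14o_comul w = w \<otimes> g + h \<otimes> w" for w x f
    using pairing_mult_comul[OF dual_coproduct_comul[of w]] by (simp add: that pairing2_left)
  show "pairing u f = pairing v f"
    by (induction f rule: S14o_induct)
      (use assms(3-) in \<open>auto simp: *[OF u] *[OF v] clinear_add[OF clinear_pairing] clinear_scale[OF clinear_pairing]\<close>)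
qed

text \<open>\<open>K * K\<close> is group-like, hence a character of S14o, and it agrees with the
  counit on the generators.\<close>

lemma s14o_K_square: "s14o_K * s14o_K = 1"
proof (rule pairing_eqI)
  fix f
  have K: "pairing (s14o_K * s14o_K) (x * f) = pairing (s14o_K * s14o_K) x * pairing (s14o_K * s14o_K) f" for x f
    by (simp add: pairing_mult_comul[OF dual_coproduct_mult[OF dual_coproduct_gens(5,5)]])
  have v: "pairing (s14o_K * s14o_K) x = pairing 1 x" if "x \<in> {1, S14o_a, S14o_b, S14o_c, S14o_d}" for x
    using that by (auto simp: pairing_mult pairing2_right algebra_homD(2)[OF algebra_hom_S14o_comul] one_tensor_def)
  show "pairing (s14o_K * s14o_K) f = pairing 1 f"
    by (induction f rule: S14o_induct)
      (use v in \<open>simp_all add: K pairing_gens_mult clinear_add[OF clinear_pairing] clinear_scale[OF clinear_pairing]\<close>)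
qed

lemmas s14o_comul_simps = clinear_add[OF algebra_homD(1)[OF algebra_hom_s14o_comul]]
  clinear_diff[OF algebra_homD(1)[OF algebra_hom_s14o_comul]]
  clinear_minus[OF algebra_homD(1)[OF algebra_hom_s14o_comul]]
  clinear_scale[OF algebra_homD(1)[OF algebra_hom_s14o_comul]]
  clinear_0[OF algebra_homD(1)[OF algebra_hom_s14o_comul]]
  algebra_homD(3)[OF algebra_hom_s14o_comul]

lemma s14o_K_central:
  "s14o_K * s14o_A = s14o_A * s14o_K" "s14o_K * s14o_B = s14o_B * s14o_K"
  "s14o_K * s14o_C = s14o_C * s14o_K" "s14o_K * s14o_D = s14o_D * s14o_K"
proof -
  note simps = s14o_comul_simps distrib_left distrib_right s14o_K_square
    pairing_mult pairing2_right algebra_homD(2)[OF algebra_hom_S14o_comul] one_tensor_def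
  show "s14o_K * s14o_A = s14o_A * s14o_K" "s14o_K * s14o_B = s14o_B * s14o_K"
    by (rule skew_primitive_eqI[where g = s14o_K and h = s14o_K]; simp add: simps)+
  \<comment> \<open>The coproduct of \<open>K * C\<close> is
    \<open>K * C \<otimes> K * K + K \<otimes> K * C\<close>, and \<open>K * K = 1\<close> gives
    \<open>g = 1\<close>; likewise for \<open>D\<close>.\<close>
  show "s14o_K * s14o_C = s14o_C * s14o_K" "s14o_K * s14o_D = s14o_D * s14o_K"
    by (rule skew_primitive_eqI[where g = 1 and h = s14o_K]; simp add: simps)+
qed

text \<open>The mixed terms in the coproduct of a commutator cancel because \<open>K\<close> is
  central, leaving a skew-primitive element. Each factor -2 comes from the antisymmetric part of a
  coproduct in S14o: that of \<open>d\<close> contains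
  \<open>- b \<otimes> c + c \<otimes> b\<close>, so \<open>[B, C]\<close> has value -2 at
  \<open>d\<close>.\<close>

lemma s14o_commutators:
  "commutator s14o_A s14o_B = 0" "commutator s14o_A s14o_C = 0" "commutator s14o_A s14o_D = 0"
  "commutator s14o_B s14o_C = (-2) *\<^sub>C s14o_D" "commutator s14o_B s14o_D = (-2) *\<^sub>C s14o_C"
  "commutator s14o_C s14o_D = (-2) *\<^sub>C s14o_B"
proof -
  note simps = s14o_comul_simps algebra_simps s14o_K_square s14o_K_central commutator_def
    tensor_diff_left tensor_diff_right tensor_add_left tensor_add_right tensor_minus_left
    tensor_minus_right tensor_scaleC_left tensor_scaleC_right scaleC_add_right
    pairing_mult pairing2_right algebra_homD(2)[OF algebra_hom_S14o_comul] one_tensor_def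
  \<comment> \<open>\<open>[C, D]\<close> is primitive, as \<open>B\<close> is, because its left
    term carries \<open>K * K = 1\<close>.\<close>
  show "commutator s14o_A s14o_B = 0" "commutator s14o_C s14o_D = (-2) *\<^sub>C s14o_B"
    by (rule skew_primitive_eqI[where g = 1 and h = 1]; simp add: simps)+
  show "commutator s14o_A s14o_C = 0" "commutator s14o_A s14o_D = 0"
    "commutator s14o_B s14o_C = (-2) *\<^sub>C s14o_D" "commutator s14o_B s14o_D = (-2) *\<^sub>C s14o_C"
    by (rule skew_primitive_eqI[where g = s14o_K and h = 1]; simp add: simps)+
qed

section \<open>The quantum determinant\<close>

text \<open>The signs arise by summing \<open>x * S14o_transpose 0 y\<close> over the terms
  \<open>x \<otimes> y\<close> of the coproduct of \<open>a\<close>. The same sum for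
  \<open>b\<close>, \<open>c\<close>, \<open>d\<close> is zero, so dividing by the determinant would
  give a convolution inverse of the identity on the generators.\<close>

definition S14o_det :: S14o
  where "S14o_det = S14o_a * S14o_a - S14o_b * S14o_b - S14o_c * S14o_c + S14o_d * S14o_d"

lemma S14o_relations_left:
  "S14o_b * (S14o_a * f) = S14o_a * (S14o_b * f)"
  "S14o_c * (S14o_a * f) = - (S14o_a * (S14o_c * f))"
  "S14o_d * (S14o_a * f) = - (S14o_a * (S14o_d * f))"
  "S14o_c * (S14o_b * f) = - (S14o_b * (S14o_c * f))"
  "S14o_d * (S14o_b * f) = - (S14o_b * (S14o_d * f))"
  "S14o_d * (S14o_c * f) = S14o_c * (S14o_d * f)"
  by (simp_all add: S14o_relations flip: mult.assoc)

text \<open>Generators commute up to sign, so their squares are central.\<close>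

lemma S14o_det_commute: "f * S14o_det = S14o_det * f"
proof (induction f rule: S14o_induct)
  case (gen x f)
  from gen(1) have "x * S14o_det = S14o_det * x"
    by (auto simp: S14o_det_def algebra_simps S14o_relations S14o_relations_left)
  with gen(2) show ?case by (metis mult.assoc)
qed (simp_all add: distrib_left distrib_right scaleC_mult_left scaleC_mult_right)

lemma S14o_det_power_commute: "f * S14o_det ^ k = S14o_det ^ k * f"
  by (rule commute_power[OF S14o_det_commute])

lemma S14o_comul_det: "S14o_comul S14o_det = S14o_det \<otimes> S14o_det"
  unfolding S14o_det_def
  by (simp add: clinear_add[OF algebra_homD(1)[OF algebra_hom_S14o_comul]]
      clinear_diff[OF algebra_homD(1)[OF algebra_hom_S14o_comul]]
      algebra_homD(3)[OF algebra_hom_S14o_comul] algebra_simps S14o_relations tensor_minus_left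
      tensor_minus_right tensor_add_left tensor_add_right tensor_diff_left tensor_diff_right)

lemma S14o_comul_det_power: "S14o_comul (S14o_det ^ k) = S14o_det ^ k \<otimes> S14o_det ^ k"
  by (induction k) (simp_all add: algebra_homD(2,3)[OF algebra_hom_S14o_comul] one_tensor_def
      S14o_comul_det)

lemma pairing_det:
  "pairing s14o_A S14o_det = 2" "pairing s14o_B S14o_det = 0" "pairing s14o_C S14o_det = 0"
  "pairing s14o_D S14o_det = 0" "pairing s14o_K S14o_det = 1" "pairing 1 S14o_det = 1"
  by (simp_all add: S14o_det_def clinear_add[OF clinear_pairing] clinear_diff[OF clinear_pairing]
      pairing_gens_mult)

text \<open>Among the generators of s14o only \<open>A\<close> distinguishes the powers of the
  determinant; its value \<open>2 * k\<close> is the source of all dependence on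
  \<open>k\<close>.\<close>

lemma pairing_det_power:
  "pairing 1 (S14o_det ^ k) = 1" "pairing s14o_K (S14o_det ^ k) = 1"
  "pairing s14o_A (S14o_det ^ k) = 2 * of_nat k" "pairing s14o_B (S14o_det ^ k) = 0"
  "pairing s14o_C (S14o_det ^ k) = 0" "pairing s14o_D (S14o_det ^ k) = 0"
  by (induction k) (simp_all add: pairing_det pairing_gens_mult algebra_simps)

section \<open>Twisted transposes\<close>

definition free_rev_eval :: "(letter \<Rightarrow> 'a::complex_algebra) \<Rightarrow> free_algebra \<Rightarrow> 'a"
  where "free_rev_eval g = free_extend (\<lambda>w. prod_list (map g (rev (letters w))))"

lemma clinear_free_rev_eval: "clinear (free_rev_eval g)"
  unfolding free_rev_eval_def by (rule clinear_free_extend)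

lemma free_rev_eval_single:
  "free_rev_eval g (Poly_Mapping.single w c) = c *\<^sub>C prod_list (map g (rev (letters w)))"
  by (simp add: free_rev_eval_def)

lemma free_rev_eval_1: "free_rev_eval g 1 = 1"
  by (simp add: free_rev_eval_single zero_word_def flip: single_one)

lemma free_rev_eval_gen: "free_rev_eval g (free_gen x) = g x"
  by (simp add: free_gen_def free_rev_eval_single)

lemma free_rev_eval_mult: "free_rev_eval g (p * q) = free_rev_eval g q * free_rev_eval g p"
proof (induction p rule: free_induct)
  case (single u c)
  show ?case
    by (induction q rule: free_induct)
      (simp_all add: mult_single free_rev_eval_single plus_word_def scaleC_mult_left scaleC_mult_right
        distrib_left distrib_right scaleC_add_right clinear_add[OF clinear_free_rev_eval] mult.commute)
qed (simp add: distrib_left distrib_right clinear_add[OF clinear_free_rev_eval])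

text \<open>Reversing words changes each relator at most by a sign, so the compatibility condition
  for homomorphisms also serves for anti-homomorphisms.\<close>

lemma free_rev_eval_relators:
  assumes "S14o_compatible g" "r \<in> S14o_relators"
  shows "free_rev_eval g r = 0"
  using assms unfolding S14o_compatible_def S14o_relators_def Let_def
  by (auto simp: clinear_add[OF clinear_free_rev_eval] clinear_diff[OF clinear_free_rev_eval]
      free_rev_eval_mult free_rev_eval_gen)

lemma free_rev_eval_respects:
  assumes "S14o_compatible g" "S14o_eq p q"
  shows "free_rev_eval g p = free_rev_eval g q"
proof -
  have "free_rev_eval g (p - q) = 0"
    using assms(2) unfolding S14o_eq_def S14o_ideal_def
    by (rule clinear_vanish_span[OF clinear_free_rev_eval, rotated])
      (auto simp: free_rev_eval_mult free_rev_eval_relators[OF assms(1)])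
  then show ?thesis by (simp add: clinear_diff[OF clinear_free_rev_eval])
qed

primrec transpose_letter :: "nat \<Rightarrow> letter \<Rightarrow> S14o" where
  "transpose_letter k La = S14o_det ^ k * S14o_a"
| "transpose_letter k Lb = - (S14o_det ^ k * S14o_b)"
| "transpose_letter k Lc = S14o_det ^ k * S14o_c"
| "transpose_letter k Ld = S14o_det ^ k * S14o_d"

text \<open>The central powers of the determinant collect in front, leaving the relations of the
  generators; each relation is homogeneous in \<open>b\<close>, so the sign at \<open>b\<close> does
  no harm.\<close>

lemma compatible_transpose_letter: "S14o_compatible (transpose_letter k)"
proof -
  have *: "S14o_det ^ k * f * (S14o_det ^ k * g) = S14o_det ^ k * S14o_det ^ k * (f * g)" for f g
    using S14o_det_power_commute[of f k] by (metis mult.assoc)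
  show ?thesis
    unfolding S14o_compatible_def by (simp add: * S14o_relations)
qed

text \<open>At \<open>k = -1\<close> this would be the antipode of the localization of S14o at the determinant.\<close>

definition S14o_transpose :: "nat \<Rightarrow> S14o \<Rightarrow> S14o"
  where "S14o_transpose k f = free_rev_eval (transpose_letter k) (rep_S14o f)"

lemma S14o_transpose_abs: "S14o_transpose k (abs_S14o p) = free_rev_eval (transpose_letter k) p"
proof -
  have "S14o_eq (rep_S14o (abs_S14o p)) p"
    using Quotient3_S14o by (metis Quotient3_def S14o.abs_eq_iff)
  then show ?thesis
    unfolding S14o_transpose_def by (rule free_rev_eval_respects[OF compatible_transpose_letter])
qed

lemma clinear_S14o_transpose: "clinear (S14o_transpose k)"
proof (rule clinearI)
  fix f g c
  show "S14o_transpose k (f + g) = S14o_transpose k f + S14o_transpose k g"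
    by (induction f rule: S14o.abs_induct, induction g rule: S14o.abs_induct)
      (simp add: plus_S14o.abs_eq S14o_transpose_abs clinear_add[OF clinear_free_rev_eval])
  show "S14o_transpose k (c *\<^sub>C f) = c *\<^sub>C S14o_transpose k f"
    by (induction f rule: S14o.abs_induct)
      (simp add: scaleC_S14o.abs_eq S14o_transpose_abs clinear_scale[OF clinear_free_rev_eval])
qed

lemma S14o_transpose_mult: "S14o_transpose k (f * g) = S14o_transpose k g * S14o_transpose k f"
  by (induction f rule: S14o.abs_induct, induction g rule: S14o.abs_induct)
    (simp add: times_S14o.abs_eq S14o_transpose_abs free_rev_eval_mult)

lemma S14o_transpose_gens [simp]:
  "S14o_transpose k 1 = 1" "S14o_transpose k S14o_a = S14o_det ^ k * S14o_a"
  "S14o_transpose k S14o_b = - (S14o_det ^ k * S14o_b)"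
  "S14o_transpose k S14o_c = S14o_det ^ k * S14o_c" "S14o_transpose k S14o_d = S14o_det ^ k * S14o_d"
  by (simp_all add: one_S14o.abs_eq S14o_a.abs_eq S14o_b.abs_eq S14o_c.abs_eq S14o_d.abs_eq
      S14o_transpose_abs free_rev_eval_1 free_rev_eval_gen)

text \<open>Both sides reverse products, so generators suffice. There the determinant power is
  group-like, and the sign at \<open>b\<close> makes up for the sign change of the antisymmetric
  part of the coproduct under the flip.\<close>

lemma S14o_comul_transpose:
  "S14o_comul (S14o_transpose k f) =
    tensor_lift (\<lambda>x y. S14o_transpose k y \<otimes> S14o_transpose k x) (S14o_comul f)"
proof -
  note T = clinear_add[OF clinear_S14o_transpose] clinear_scale[OF clinear_S14o_transpose]
  note \<delta> = algebra_homD[OF algebra_hom_S14o_comul]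
  let ?R = "tensor_lift (\<lambda>x y. S14o_transpose k y \<otimes> S14o_transpose k x)"
  have B: "cbilinear (\<lambda>x y. S14o_transpose k y \<otimes> S14o_transpose k x)"
    by (rule cbilinearI) (simp_all add: T tensor_add_left tensor_add_right tensor_scaleC_left
        tensor_scaleC_right)
  note R = clinear_add[OF clinear_tensor_lift[OF B]] clinear_diff[OF clinear_tensor_lift[OF B]]
    clinear_scale[OF clinear_tensor_lift[OF B]]
  have mult: "?R (F * G) = ?R G * ?R F" for F G
  proof (induction F rule: tensor_induct)
    case (pure x y)
    show ?case
      by (induction G rule: tensor_induct) (simp_all add: B S14o_transpose_mult distrib_left distrib_right R)
  qed (simp add: distrib_left distrib_right R)
  have gens: "S14o_comul (S14o_transpose k x) = ?R (S14o_comul x)"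
    if "x \<in> {S14o_a, S14o_b, S14o_c, S14o_d}" for x
    using that
    by (auto simp: \<delta>(3) clinear_minus[OF \<delta>(1)] S14o_comul_det_power R B distrib_left right_diff_distrib
        tensor_minus_left tensor_minus_right)
  show ?thesis
    by (induction f rule: S14o_induct)
      (simp_all add: \<delta>(2,3) one_tensor_def B S14o_transpose_mult gens mult T R clinear_add[OF \<delta>(1)] clinear_scale[OF \<delta>(1)])
qed

text \<open>Because \<open>S14o_transpose k\<close> flips the coproduct, precomposing functionals
  with it reverses their product.\<close>

lemma pairing_mult_transpose:
  "pairing (u * v) (S14o_transpose k f) =
    tensor_lift (\<lambda>x y. pairing v (S14o_transpose k x) * pairing u (S14o_transpose k y)) (S14o_comul f)"
proof -
  note T = clinear_add[OF clinear_S14o_transpose] clinear_scale[OF clinear_S14o_transpose]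
  note P = cbilinearD[OF cbilinear_pairing]
  have B: "cbilinear (\<lambda>x y. S14o_transpose k y \<otimes> S14o_transpose k x)"
    by (rule cbilinearI) (simp_all add: T tensor_add_left tensor_add_right tensor_scaleC_left
        tensor_scaleC_right)
  have B': "cbilinear (\<lambda>x y. pairing v (S14o_transpose k x) * pairing u (S14o_transpose k y))"
    by (rule cbilinearI) (simp_all add: T P algebra_simps)
  have "pairing2 (u \<otimes> v) (tensor_lift (\<lambda>x y. S14o_transpose k y \<otimes> S14o_transpose k x) F) =
      tensor_lift (\<lambda>x y. pairing v (S14o_transpose k x) * pairing u (S14o_transpose k y)) F" for F
    by (rule clinear_tensor_eqI[OF clinear_compose[OF clinear_pairing2 clinear_tensor_lift[OF B]]
          clinear_tensor_lift[OF B']])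
      (unfold tensor_lift_tensor[OF B] tensor_lift_tensor[OF B'] pairing2_tensor, rule mult.commute)
  then show ?thesis
    by (simp add: pairing_mult S14o_comul_transpose)
qed

lemma pairing_grouplike_transpose:
  "pairing 1 (S14o_transpose k f) = pairing 1 f" "pairing s14o_K (S14o_transpose k f) = pairing s14o_K f"
  by (induction f rule: S14o_induct;
      auto simp: S14o_transpose_mult pairing_gens_mult pairing_det_power clinear_minus[OF clinear_pairing]
        clinear_add[OF clinear_S14o_transpose] clinear_scale[OF clinear_S14o_transpose]
        clinear_add[OF clinear_pairing] clinear_scale[OF clinear_pairing])+

text \<open>Since \<open>S14o_transpose k\<close> reverses products, precomposition exchanges the
  two group-like sides: \<open>g\<close> turns into \<open>h'\<close> and \<open>h\<close> into
  \<open>g'\<close>. Comparison with \<open>c * v\<close> then needs only the values at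
  \<open>1\<close> and the generators.\<close>

lemma pairing_skew_primitive_transpose:
  assumes u: "s14o_comul u = u \<otimes> g + h \<otimes> u" and v: "s14o_comul v = v \<otimes> g' + h' \<otimes> v"
    and g: "\<And>f. pairing g (S14o_transpose k f) = pairing h' f"
    and h: "\<And>f. pairing h (S14o_transpose k f) = pairing g' f"
    and gens: "\<And>x. x \<in> {1, S14o_a, S14o_b, S14o_c, S14o_d} \<Longrightarrow>
      pairing u (S14o_transpose k x) = c * pairing v x"
  shows "pairing u (S14o_transpose k f) = c * pairing v f"
proof (induction f rule: S14o_induct)
  case one
  show ?case by (rule gens) simp
next
  case (gen x f)
  have "pairing u (S14o_transpose k (x * f)) =
      pairing u (S14o_transpose k f) * pairing h' x + pairing g' f * pairing u (S14o_transpose k x)"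
    by (simp add: S14o_transpose_mult pairing_mult_comul[OF dual_coproduct_comul[of u]] u pairing2_left g h)
  moreover have "pairing u (S14o_transpose k x) = c * pairing v x"
    using gen(1) by (intro gens) blast
  moreover have "pairing v (x * f) = pairing v x * pairing g' f + pairing h' x * pairing v f"
    by (simp add: pairing_mult_comul[OF dual_coproduct_comul[of v]] v pairing2_left)
  ultimately show ?case
    using gen(2) by (simp add: algebra_simps)
qed (simp_all add: clinear_add[OF clinear_S14o_transpose] clinear_scale[OF clinear_S14o_transpose]
        clinear_add[OF clinear_pairing] clinear_scale[OF clinear_pairing] algebra_simps)

lemma pairing_transpose:
  "pairing s14o_A (S14o_transpose k f) = (1 + 2 * of_nat k) * pairing s14o_A f"
  "pairing s14o_B (S14o_transpose k f) = - pairing s14o_B f"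
  "pairing s14o_C (S14o_transpose k f) = - pairing (s14o_C * s14o_K) f"
  "pairing s14o_D (S14o_transpose k f) = - pairing (s14o_D * s14o_K) f"
proof -
  note simps = pairing_gens_mult pairing_det_power clinear_minus[OF clinear_pairing]
    pairing_mult pairing2_right algebra_homD(2)[OF algebra_hom_S14o_comul] one_tensor_def
  note grouplike = pairing_grouplike_transpose
  \<comment> \<open>At \<open>a\<close> the factor is \<open>2 * k\<close> from the determinant
    power plus 1 from \<open>a\<close>; at \<open>k = -1\<close> it becomes -1.\<close>
  show "pairing s14o_A (S14o_transpose k f) = (1 + 2 * of_nat k) * pairing s14o_A f"
    by (rule pairing_skew_primitive_transpose[where g = 1 and h = 1 and g' = 1 and h' = 1])
      (auto simp: simps grouplike)
  have "pairing s14o_B (S14o_transpose k f) = (-1) * pairing s14o_B f"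
    by (rule pairing_skew_primitive_transpose[where g = 1 and h = 1 and g' = 1 and h' = 1])
      (auto simp: simps grouplike)
  then show "pairing s14o_B (S14o_transpose k f) = - pairing s14o_B f" by simp
  \<comment> \<open>The exchange of sides calls for an element with \<open>g' = 1\<close> and
    \<open>h' = K\<close>: this is \<open>C * K\<close>, as \<open>K * K = 1\<close>. The factor is
    -1 since \<open>C * K\<close> has value \<open>K a = -1\<close> at \<open>c\<close>.\<close>
  have "pairing s14o_C (S14o_transpose k f) = (-1) * pairing (s14o_C * s14o_K) f"
    by (rule pairing_skew_primitive_transpose[where g = s14o_K and h = 1 and g' = 1 and h' = s14o_K])
      (auto simp: simps grouplike s14o_comul_simps s14o_K_square distrib_right)
  then show "pairing s14o_C (S14o_transpose k f) = - pairing (s14o_C * s14o_K) f" by simp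
  have "pairing s14o_D (S14o_transpose k f) = (-1) * pairing (s14o_D * s14o_K) f"
    by (rule pairing_skew_primitive_transpose[where g = s14o_K and h = 1 and g' = 1 and h' = s14o_K])
      (auto simp: simps grouplike s14o_comul_simps s14o_K_square distrib_right)
  then show "pairing s14o_D (S14o_transpose k f) = - pairing (s14o_D * s14o_K) f" by simp
qed

section \<open>The antipode of s14o\<close>

text \<open>A relation, because \<open>v\<close> has to be found in s14o; interpolation at
  \<open>k = -1\<close> makes it single-valued.\<close>

definition antipodal :: "s14o \<Rightarrow> s14o \<Rightarrow> bool"
  where "antipodal u v \<longleftrightarrow> (\<forall>f. \<exists>p. (\<forall>k. pairing u (S14o_transpose k f) = poly p (of_nat k)) \<and>
    pairing v f = poly p (-1))"

text \<open>On generators the dependence on \<open>k\<close> is affine, and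
  \<open>\<alpha> - \<beta>\<close> is its value at \<open>k = -1\<close>.\<close>

lemma antipodal_linearI:
  assumes "\<And>f k. pairing u (S14o_transpose k f) = (\<alpha> + of_nat k * \<beta>) * pairing w f"
    and "v = (\<alpha> - \<beta>) *\<^sub>C w"
  shows "antipodal u v"
  unfolding antipodal_def
proof
  fix f
  show "\<exists>p. (\<forall>k. pairing u (S14o_transpose k f) = poly p (of_nat k)) \<and> pairing v f = poly p (-1)"
    by (rule exI[of _ "smult (pairing w f) [:\<alpha>, \<beta>:]"]) (simp add: assms algebra_simps)
qed

lemma antipodal_gens:
  "antipodal s14o_A (- s14o_A)" "antipodal s14o_B (- s14o_B)"
  "antipodal s14o_C (- (s14o_C * s14o_K))" "antipodal s14o_D (- (s14o_D * s14o_K))"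
  "antipodal s14o_K s14o_K" "antipodal 1 1"
proof -
  show "antipodal s14o_A (- s14o_A)"
    by (rule antipodal_linearI[where \<alpha> = 1 and \<beta> = 2 and w = s14o_A])
      (simp_all add: pairing_transpose mult.commute)
  show "antipodal s14o_B (- s14o_B)"
    by (rule antipodal_linearI[where \<alpha> = "-1" and \<beta> = 0 and w = s14o_B])
      (simp_all add: pairing_transpose)
  show "antipodal s14o_C (- (s14o_C * s14o_K))"
    by (rule antipodal_linearI[where \<alpha> = "-1" and \<beta> = 0 and w = "s14o_C * s14o_K"])
      (simp_all add: pairing_transpose)
  show "antipodal s14o_D (- (s14o_D * s14o_K))"
    by (rule antipodal_linearI[where \<alpha> = "-1" and \<beta> = 0 and w = "s14o_D * s14o_K"])
      (simp_all add: pairing_transpose)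
  show "antipodal s14o_K s14o_K" "antipodal 1 1"
    by (rule antipodal_linearI[where \<alpha> = 1 and \<beta> = 0]; simp add: pairing_grouplike_transpose)+
qed

lemma antipodal_add:
  assumes "antipodal u u'" "antipodal v v'"
  shows "antipodal (u + v) (u' + v')"
  unfolding antipodal_def
proof
  fix f
  obtain p q where "\<And>k. pairing u (S14o_transpose k f) = poly p (of_nat k)" "pairing u' f = poly p (-1)"
    "\<And>k. pairing v (S14o_transpose k f) = poly q (of_nat k)" "pairing v' f = poly q (-1)"
    using assms unfolding antipodal_def by metis
  then show "\<exists>p. (\<forall>k. pairing (u + v) (S14o_transpose k f) = poly p (of_nat k)) \<and>
      pairing (u' + v') f = poly p (-1)"
    by (intro exI[of _ "p + q"]) simp
qed

lemma antipodal_scaleC: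
  assumes "antipodal u u'"
  shows "antipodal (c *\<^sub>C u) (c *\<^sub>C u')"
  unfolding antipodal_def
proof
  fix f
  obtain p where "\<And>k. pairing u (S14o_transpose k f) = poly p (of_nat k)" "pairing u' f = poly p (-1)"
    using assms unfolding antipodal_def by metis
  then show "\<exists>p. (\<forall>k. pairing (c *\<^sub>C u) (S14o_transpose k f) = poly p (of_nat k)) \<and>
      pairing (c *\<^sub>C u') f = poly p (-1)"
    by (intro exI[of _ "smult c p"]) simp
qed

lemma antipodal_mult:
  assumes u: "antipodal u u'" and v: "antipodal v v'"
  shows "antipodal (u * v) (v' * u')"
proof -
  note T = clinear_add[OF clinear_S14o_transpose] clinear_scale[OF clinear_S14o_transpose]
  note P = cbilinearD[OF cbilinear_pairing]
  let ?F = "\<lambda>k. tensor_lift (\<lambda>x y. pairing v (S14o_transpose k x) * pairing u (S14o_transpose k y))"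
  have B: "cbilinear (\<lambda>x y. pairing v (S14o_transpose k x) * pairing u (S14o_transpose k y))" for k
    by (rule cbilinearI) (simp_all add: T P algebra_simps)
  \<comment> \<open>Stated for every tensor, not only for coproducts, so that tensor induction
    applies: polynomials multiply on pure tensors and add on sums.\<close>
  have *: "\<exists>p. (\<forall>k. ?F k t = poly p (of_nat k)) \<and> pairing2 (v' \<otimes> u') t = poly p (-1)" for t
  proof (induction t rule: tensor_induct)
    case (pure x y)
    obtain p q where "\<And>k. pairing v (S14o_transpose k x) = poly p (of_nat k)" "pairing v' x = poly p (-1)"
      "\<And>k. pairing u (S14o_transpose k y) = poly q (of_nat k)" "pairing u' y = poly q (-1)"
      using assms unfolding antipodal_def by metis
    then show ?case by (intro exI[of _ "p * q"]) (simp add: B)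
  next
    case (add s t)
    then obtain p q where "\<And>k. ?F k s = poly p (of_nat k)" "pairing2 (v' \<otimes> u') s = poly p (-1)"
      "\<And>k. ?F k t = poly q (of_nat k)" "pairing2 (v' \<otimes> u') t = poly q (-1)"
      by blast
    then show ?case by (intro exI[of _ "p + q"]) (simp add: tensor_lift_add[OF B] pairing2_right)
  qed
  show ?thesis
    unfolding antipodal_def pairing_mult_transpose pairing_mult[of v'] using * by blast
qed

lemma poly_eq_on_nats:
  fixes p q :: "complex poly"
  assumes "\<And>k::nat. poly p (of_nat k) = poly q (of_nat k)"
  shows "p = q"
proof (rule ccontr)
  assume "p \<noteq> q"
  then have "finite {x. poly (p - q) x = 0}" by (intro poly_roots_finite) simp
  moreover have "range of_nat \<subseteq> {x. poly (p - q) x = 0}" using assms by auto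
  ultimately show False
    using infinite_super range_inj_infinite[OF inj_of_nat] by blast
qed

lemma antipodal_unique:
  assumes "antipodal u v" "antipodal u w"
  shows "v = w"
proof (rule pairing_eqI)
  fix f
  obtain p q where p: "\<And>k. pairing u (S14o_transpose k f) = poly p (of_nat k)" "pairing v f = poly p (-1)"
    and q: "\<And>k. pairing u (S14o_transpose k f) = poly q (of_nat k)" "pairing w f = poly q (-1)"
    using assms unfolding antipodal_def by metis
  from p(1) q(1) have "p = q" by (intro poly_eq_on_nats) simp
  with p(2) q(2) show "pairing v f = pairing w f" by simp
qed

lemma antipodal_exists: "\<exists>v. antipodal u v"
  by (induction u rule: s14o_induct)
    (use antipodal_gens antipodal_add antipodal_scaleC antipodal_mult in blast)+

definition s14o_antipode :: "s14o \<Rightarrow> s14o"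
  where "s14o_antipode u = (THE v. antipodal u v)"

lemma s14o_antipode_eqI: "antipodal u v \<Longrightarrow> s14o_antipode u = v"
  unfolding s14o_antipode_def using antipodal_unique by blast

lemma antipodal_antipode: "antipodal u (s14o_antipode u)"
  using antipodal_exists s14o_antipode_eqI by metis

lemmas s14o_antipode_gens [simp] = antipodal_gens[THEN s14o_antipode_eqI]

section \<open>The antipode axioms\<close>

lemma s14o_antipode_mult: "s14o_antipode (u * v) = s14o_antipode v * s14o_antipode u"
  by (intro s14o_antipode_eqI antipodal_mult antipodal_antipode)

lemma clinear_s14o_antipode: "clinear s14o_antipode"
  by (intro clinearI s14o_antipode_eqI antipodal_add antipodal_scaleC antipodal_antipode)

text \<open>Anti-multiplicativity nests the sums: for \<open>\<gamma> x * y\<close> the sum over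
  \<open>s\<close> lies inside that over \<open>t\<close> and collapses to the scalar
  \<open>c\<close>; for \<open>x * \<gamma> y\<close> the sum over \<open>t\<close> is the inner
  one. Hence the antipode axioms pass to products.\<close>

lemma antipode_convolution_mult:
  fixes \<gamma> :: "'a::complex_algebra \<Rightarrow> 'a"
  assumes \<gamma>: "clinear \<gamma>" and mult: "\<And>x y. \<gamma> (x * y) = \<gamma> y * \<gamma> x"
  shows "tensor_lift (\<lambda>x y. \<gamma> x * y) s = c *\<^sub>C 1 \<Longrightarrow>
      tensor_lift (\<lambda>x y. \<gamma> x * y) (s * t) = c *\<^sub>C tensor_lift (\<lambda>x y. \<gamma> x * y) t" (is "?s \<Longrightarrow> _")
    and "tensor_lift (\<lambda>x y. x * \<gamma> y) t = c *\<^sub>C 1 \<Longrightarrow>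
      tensor_lift (\<lambda>x y. x * \<gamma> y) (s * t) = c *\<^sub>C tensor_lift (\<lambda>x y. x * \<gamma> y) s" (is "?t \<Longrightarrow> _")
proof -
  have B: "cbilinear (\<lambda>x y. \<gamma> x * y)" "cbilinear (\<lambda>x y. x * \<gamma> y)"
    using cbilinear_compose[OF cbilinear_mult \<gamma> clinear_ident(1)]
      cbilinear_compose[OF cbilinear_mult clinear_ident(1) \<gamma>] by simp_all
  note L = clinear_add[OF clinear_tensor_lift[OF B(1)]] clinear_add[OF clinear_tensor_lift[OF B(2)]]
  have 1: "tensor_lift (\<lambda>x y. \<gamma> x * y) (s * (x \<otimes> y)) = \<gamma> x * tensor_lift (\<lambda>x y. \<gamma> x * y) s * y" for x y
    by (induction s rule: tensor_induct) (simp_all add: B mult distrib_left distrib_right L mult.assoc)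
  have 2: "tensor_lift (\<lambda>x y. x * \<gamma> y) ((x \<otimes> y) * t) = x * tensor_lift (\<lambda>x y. x * \<gamma> y) t * \<gamma> y" for x y
    by (induction t rule: tensor_induct) (simp_all add: B mult distrib_left distrib_right L mult.assoc)
  show "tensor_lift (\<lambda>x y. \<gamma> x * y) (s * t) = c *\<^sub>C tensor_lift (\<lambda>x y. \<gamma> x * y) t" if ?s
    by (induction t rule: tensor_induct)
      (simp_all add: 1 that B distrib_left L scaleC_add_right scaleC_mult_left scaleC_mult_right)
  show "tensor_lift (\<lambda>x y. x * \<gamma> y) (s * t) = c *\<^sub>C tensor_lift (\<lambda>x y. x * \<gamma> y) s" if ?t
    by (induction s rule: tensor_induct)
      (simp_all add: 2 that B distrib_right L scaleC_add_right scaleC_mult_left scaleC_mult_right)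
qed

text \<open>Induction over s14o with \<open>antipode_convolution_mult\<close> for products. On
  generators the axioms are short identities; for \<open>C\<close> they are
  \<open>- C * K * K + C = 0\<close> and \<open>C * K - C * K = 0\<close>, the first by
  \<open>K * K = 1\<close>.\<close>

lemma antipode_s14o: "antipode s14o_comul s14o_counit s14o_antipode"
proof -
  note \<gamma> = clinear_s14o_antipode
  note e = algebra_homD[OF algebra_hom_s14o_counit]
  have B: "cbilinear (\<lambda>x y. s14o_antipode x * y)" "cbilinear (\<lambda>x y. x * s14o_antipode y)"
    using cbilinear_compose[OF cbilinear_mult \<gamma> clinear_ident(1)]
      cbilinear_compose[OF cbilinear_mult clinear_ident(1) \<gamma>] by simp_all
  note L = clinear_add[OF clinear_tensor_lift[OF B(1)]] clinear_add[OF clinear_tensor_lift[OF B(2)]]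
    clinear_scale[OF clinear_tensor_lift[OF B(1)]] clinear_scale[OF clinear_tensor_lift[OF B(2)]]
  note simps = B L s14o_comul_simps s14o_K_square s14o_K_central mult.assoc
    clinear_add[OF e(1)] clinear_scale[OF e(1)] scaleC_add_left e(3)
  have 1: "tensor_lift (\<lambda>x y. s14o_antipode x * y) (s14o_comul u) = s14o_counit u *\<^sub>C 1" for u
  proof (induction u rule: s14o_induct)
    case (mult u v)
    then show ?case
      by (simp add: simps antipode_convolution_mult(1)[OF \<gamma> s14o_antipode_mult mult(1)])
  qed (simp_all add: simps)
  have 2: "tensor_lift (\<lambda>x y. x * s14o_antipode y) (s14o_comul u) = s14o_counit u *\<^sub>C 1" for u
  proof (induction u rule: s14o_induct)
    case (mult u v)
    then show ?case
      by (simp add: simps antipode_convolution_mult(2)[OF \<gamma> s14o_antipode_mult mult(2)] mult.commute)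
  qed (simp_all add: simps)
  show ?thesis
    using 1 2 \<gamma> by (simp add: antipode_def tensor_lift_tensor_map[OF cbilinear_mult] clinear_ident)
qed

text \<open>\<open>s14o_comul\<close> is a definite description; the unique-existence clause is what
  ties it to the product of S14o.\<close>

theorem proposition3:
  shows
   "(\<forall>Z \<in> {s14o_B, s14o_C, s14o_D}. commutator s14o_A Z = 0) \<and>
    commutator s14o_B s14o_C = (-2) *\<^sub>C s14o_D \<and>
    commutator s14o_B s14o_D = (-2) *\<^sub>C s14o_C \<and>
    commutator s14o_C s14o_D = (-2) *\<^sub>C s14o_B \<and>
    (\<forall>u. \<exists>!t. dual_coproduct u t) \<and>
    bialgebra s14o_comul s14o_counit \<and>
    s14o_comul s14o_A = s14o_A \<otimes> 1 + 1 \<otimes> s14o_A \<and>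
    s14o_comul s14o_B = s14o_B \<otimes> 1 + 1 \<otimes> s14o_B \<and>
    s14o_comul s14o_C = s14o_C \<otimes> s14o_K + 1 \<otimes> s14o_C \<and>
    s14o_comul s14o_D = s14o_D \<otimes> s14o_K + 1 \<otimes> s14o_D \<and>
    (\<forall>Z \<in> {s14o_A, s14o_B, s14o_C, s14o_D}. s14o_counit Z = 0) \<and>
    (\<exists>\<gamma>. antipode s14o_comul s14o_counit \<gamma> \<and>
       \<gamma> s14o_A = - s14o_A \<and>
       \<gamma> s14o_B = - s14o_B \<and>
       \<gamma> s14o_C = - (s14o_C * s14o_K) \<and>
       \<gamma> s14o_D = - (s14o_D * s14o_K))"
  using antipode_s14o
  by (simp add: s14o_commutators dual_coproduct_ex1 bialgebra_s14o) (rule exI[of _ s14o_antipode], simp)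

end
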